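(* Let $N\ge4$ be an integer. The heat semigroup $T_t^S$ on $S_N^+$, with generator $T_L$, satisfies the spectral gap inequality with constant $m=\frac1N$: for all $x\in\mathrm{Pol}(S_N^+)_+$, $$\frac1N\,\|x-h(x)1\|_2^2\le-h(x\,T_Lx).$$
   Context: $U_s(X)=\sum_{p=0}^{\lfloor s/2\rfloor}(-1)^p\binom{s-p}{p}X^{s-2p}$ are the Chebyshev polynomials of the second kind (rescaled to $[-2,2]$): $U_0=1$, $U_1=X$, $XU_s=U_{s+1}+U_{s-1}$. $S_N^+$: the compact quantum group whose universal $C^*$-algebra is generated by $u_{ij}$, $1\le i,j\le N$, with $u_{ij}^2=u_{ij}=u_{ij}^*$, $\sum_k u_{ik}=1=\sum_k u_{kj}$, and $\Delta(u_{ij})=\sum_k u_{ik}\otimes u_{kj}$. For $N\ge4$ its irreducible corepresentations are $u^{(s)}$, $s\in\mathbb{N}=\{0,1,2,\dots\}$, with $u^{(0)}=1$, $(u_{ij})\cong u^{(0)}\oplus u^{(1)}$, $u^{(1)}\otimes u^{(s)}\cong u^{(s+1)}\oplus u^{(s)}\oplus u^{(s-1)}$ for $s\ge1$, and $\dim u^{(s)}=U_{2s}(\sqrt N)$. $V_s$ is the span of the coefficients $u_{ij}^{(s)}$ and $\mathrm{Pol}(S_N^+)=\bigoplus_sV_s$. The Haar state $h$ is a faithful trace on $\mathrm{Pol}(S_N^+)$, and $\|x\|_2=h(x^*x)^{1/2}$. $\mathrm{Pol}(S_N^+)_+$ is the set of $x\in\mathrm{Pol}(S_N^+)$ with $|x|=x$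 (absolute value taken in the von Neumann algebra $L^\infty(S_N^+)$ generated by $\mathrm{Pol}(S_N^+)$ in the GNS representation of $h$). The heat semigroup is $T_t^S=\exp(tT_L)$, where the generator $T_L:\mathrm{Pol}(S_N^+)\to\mathrm{Pol}(S_N^+)$ is given by $T_Lx=-\frac{U_{2s}'(\sqrt N)}{2\sqrt N\,U_{2s}(\sqrt N)}x$ for $x\in V_s$. *)

theory Defs
  imports
    "HOL-Analysis.Analysis"
    "HOL-Library.Poly_Mapping"
    "HOL-Library.Complex_Order"
    "HOL-Computational_Algebra.Polynomial"
begin

section \<open>Complex vector spaces, *-algebras, Hilbert spaces\<close>

class complex_vector = ab_group_add +
  fixes scaleC :: "complex \<Rightarrow> 'a \<Rightarrow> 'a"  (infixr "*\<^sub>C" 75)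
  assumes scaleC_add_right: "c *\<^sub>C (x + y) = c *\<^sub>C x + c *\<^sub>C y"
    and scaleC_add_left: "(b + c) *\<^sub>C x = b *\<^sub>C x + c *\<^sub>C x"
    and scaleC_scaleC: "b *\<^sub>C c *\<^sub>C x = (b * c) *\<^sub>C x"
    and scaleC_one: "1 *\<^sub>C x = x"

instantiation complex :: complex_vector
begin
definition scaleC_complex :: "complex \<Rightarrow> complex \<Rightarrow> complex"
  where "scaleC_complex c x = c * x"
instance
  by standard (simp_all add: scaleC_complex_def algebra_simps)
end

text \<open>Unital associative complex *-algebras. The zero algebra is admitted, so that the
  quotient below is an instance without a proof that it is nonzero.\<close>

class star_algebra = complex_vector + ring + monoid_mult +
  fixes star :: "'a \<Rightarrow> 'a"
  assumes mult_scaleC_left: "(c *\<^sub>C x) * y = c *\<^sub>C (x * y)"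
    and mult_scaleC_right: "x * (c *\<^sub>C y) = c *\<^sub>C (x * y)"
    and star_star: "star (star x) = x"
    and star_add: "star (x + y) = star x + star y"
    and star_mult: "star (x * y) = star y * star x"
    and star_scaleC: "star (c *\<^sub>C x) = cnj c *\<^sub>C star x"

class complex_hilbert_space = complex_vector + banach +
  fixes cinner :: "'a \<Rightarrow> 'a \<Rightarrow> complex"
  assumes scaleR_eq_scaleC: "r *\<^sub>R x = complex_of_real r *\<^sub>C x"
    and cinner_commute: "cinner x y = cnj (cinner y x)"
    and cinner_add_right: "cinner x (y + z) = cinner x y + cinner x z"
    and cinner_scaleC_right: "cinner x (c *\<^sub>C y) = c * cinner x y"
    and cinner_ge_zero: "0 \<le> cinner x x"
    and norm_eq_sqrt_cinner: "norm x = sqrt (Re (cinner x x))"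

instantiation complex :: complex_hilbert_space
begin
definition cinner_complex :: "complex \<Rightarrow> complex \<Rightarrow> complex"
  where "cinner_complex x y = cnj x * y"
instance
  by standard
    (simp_all add: cinner_complex_def scaleC_complex_def scaleR_conv_of_real algebra_simps
      less_eq_complex_def cmod_def power2_eq_square)
end

definition clinear :: "('a::complex_vector \<Rightarrow> 'b::complex_vector) \<Rightarrow> bool" where
  "clinear f \<longleftrightarrow> (\<forall>x y. f (x + y) = f x + f y) \<and> (\<forall>c x. f (c *\<^sub>C x) = c *\<^sub>C f x)"

definition unital_star_hom :: "('a::star_algebra \<Rightarrow> 'b::star_algebra) \<Rightarrow> bool" where
  "unital_star_hom f \<longleftrightarrow> clinear f \<and> f 1 = 1 \<and> (\<forall>x y. f (x * y) = f x * f y) \<and>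
     (\<forall>x. f (star x) = star (f x))"


section \<open>The free *-algebra on self-adjoint generators\<close>

datatype 'g word = Word (letters: "'g list")

instantiation word :: (type) monoid_add
begin
definition zero_word :: "'a word" where "zero_word = Word []"
definition plus_word :: "'a word \<Rightarrow> 'a word \<Rightarrow> 'a word"
  where "plus_word v w = Word (letters v @ letters w)"
instance
  by standard (simp_all add: zero_word_def plus_word_def)
end

text \<open>Noncommutative polynomials are the monoid algebra of the free monoid; the generators
  are self-adjoint, so the involution reverses words and conjugates coefficients.\<close>

type_synonym 'n ncpoly = "('n \<times> 'n) word \<Rightarrow>\<^sub>0 complex"

definition gen :: "'n \<Rightarrow> 'n \<Rightarrow> 'n ncpoly" where
  "gen i j = Poly_Mapping.single (Word [(i, j)]) 1"

definition ncscale :: "complex \<Rightarrow> 'n ncpoly \<Rightarrow> 'n ncpoly" where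
  "ncscale c a = Poly_Mapping.single 0 c * a"

definition wrev :: "'g word \<Rightarrow> 'g word" where
  "wrev w = Word (rev (letters w))"

lemma wrev_wrev [simp]: "wrev (wrev w) = w"
  by (simp add: wrev_def)

lemma wrev_add: "wrev (v + w) = wrev w + wrev v"
  by (simp add: wrev_def plus_word_def)

lemma wrev_zero [simp]: "wrev 0 = 0"
  by (simp add: wrev_def zero_word_def)

lemma inj_wrev: "inj wrev"
  by (metis injI wrev_wrev)

lift_definition ncstar :: "'n ncpoly \<Rightarrow> 'n ncpoly" is "\<lambda>a w. cnj (a (wrev w))"
proof -
  fix a :: "('n \<times> 'n) word \<Rightarrow> complex"
  assume "finite {w. a w \<noteq> 0}"
  then have "finite (wrev -` {w. a w \<noteq> 0})"
    by (rule finite_vimageI) (rule inj_wrev)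
  then show "finite {w. cnj (a (wrev w)) \<noteq> 0}"
    by (simp add: vimage_def)
qed

lemma lookup_ncstar: "Poly_Mapping.lookup (ncstar a) w = cnj (Poly_Mapping.lookup a (wrev w))"
  by transfer simp

lemma ncstar_ncstar: "ncstar (ncstar a) = a"
  by (rule poly_mapping_eqI) (simp add: lookup_ncstar)

lemma ncstar_add: "ncstar (a + b) = ncstar a + ncstar b"
  by (rule poly_mapping_eqI) (simp add: lookup_ncstar lookup_add)

lemma ncstar_minus: "ncstar (a - b) = ncstar a - ncstar b"
  by (rule poly_mapping_eqI) (simp add: lookup_ncstar lookup_minus)

lemma ncstar_single: "ncstar (Poly_Mapping.single w c) = Poly_Mapping.single (wrev w) (cnj c)"
  by (rule poly_mapping_eqI) (auto simp add: lookup_ncstar lookup_single when_def)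

lemma ncstar_zero: "ncstar 0 = 0"
  by (rule poly_mapping_eqI) (simp add: lookup_ncstar)

lemma ncpoly_induct:
  fixes a :: "'n ncpoly"
  assumes "P 0" and "\<And>a w c. P a \<Longrightarrow> P (a + Poly_Mapping.single w c)"
  shows "P a"
proof (induction a rule: update_induct)
  case const
  then show ?case using assms(1) by simp
next
  case (update f k v)
  have "Poly_Mapping.update k v f = f + Poly_Mapping.single k v"
    using update(1)
    by (intro poly_mapping_eqI)
      (auto simp: lookup_update lookup_add lookup_single when_def in_keys_iff)
  then show ?case using assms(2) update by simp
qed

lemma ncstar_mult: "ncstar (a * b) = ncstar b * ncstar a"
proof (induction a rule: ncpoly_induct)
  case 1
  show ?case by (simp add: ncstar_zero)
next
  case (2 a v c)
  have "ncstar (Poly_Mapping.single v c * b) = ncstar b * ncstar (Poly_Mapping.single v c)"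
  proof (induction b rule: ncpoly_induct)
    case 1
    show ?case by (simp add: ncstar_zero)
  next
    case (2 b w d)
    then show ?case
      by (simp add: algebra_simps ncstar_add ncstar_single mult_single wrev_add)
  qed
  with 2 show ?case by (simp add: algebra_simps ncstar_add)
qed

lemma ncscale_mult_right: "a * ncscale c b = ncscale c (a * b)"
proof -
  have "a * Poly_Mapping.single 0 c = Poly_Mapping.single 0 c * a"
    by (induction a rule: ncpoly_induct) (simp_all add: algebra_simps mult_single)
  then show ?thesis by (simp add: ncscale_def flip: mult.assoc)
qed

lemma ncscale_minus_one: "ncscale (-1) a = - a"
  by (simp add: ncscale_def single_uminus)

lemma ncscale_diff: "ncscale c (a - b) = ncscale c a - ncscale c b"
  by (simp add: ncscale_def algebra_simps)

lemma ncstar_ncscale: "ncstar (ncscale c a) = ncscale (cnj c) (ncstar a)"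
  unfolding ncscale_def ncstar_mult ncstar_single
  using ncscale_mult_right[of "ncstar a" "cnj c" 1] by (simp add: ncscale_def)


section \<open>The *-algebra of coordinates on $S_N^+$\<close>

text \<open>The universal $C^*$-algebra of $S_N^+$ is the completion of the free *-algebra for the
  largest $C^*$-seminorm compatible with the relations; \<open>Pol\<close> is the dense *-subalgebra
  generated by the $u_{ij}$, i.e. the quotient by the elements that all these seminorms
  annihilate. Here $N$ is the cardinality of the finite index type.\<close>

definition cstar_seminorm :: "('n ncpoly \<Rightarrow> real) \<Rightarrow> bool" where
  "cstar_seminorm p \<longleftrightarrow>
     (\<forall>a b. p (a + b) \<le> p a + p b) \<and>
     (\<forall>c a. p (ncscale c a) = cmod c * p a) \<and>
     (\<forall>a b. p (a * b) \<le> p a * p b) \<and>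
     (\<forall>a. p (ncstar a * a) = (p a)\<^sup>2)"

definition magic_relations :: "('n::finite ncpoly \<Rightarrow> real) \<Rightarrow> bool" where
  "magic_relations p \<longleftrightarrow>
     (\<forall>i j. p (gen i j * gen i j - gen i j) = 0) \<and>
     (\<forall>i. p ((\<Sum>k\<in>UNIV. gen i k) - 1) = 0) \<and>
     (\<forall>j. p ((\<Sum>k\<in>UNIV. gen k j) - 1) = 0)"

definition null_poly :: "'n::finite ncpoly \<Rightarrow> bool" where
  "null_poly a \<longleftrightarrow> (\<forall>p. cstar_seminorm p \<and> magic_relations p \<longrightarrow> p a = 0)"

lemma cstar_seminorm_zero: "cstar_seminorm p \<Longrightarrow> p 0 = 0"
  unfolding cstar_seminorm_def by (metis mult_zero_left ncscale_def norm_zero single_zero)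

lemma cstar_seminorm_uminus: "cstar_seminorm p \<Longrightarrow> p (- a) = p a"
  unfolding cstar_seminorm_def
  by (metis mult_1 ncscale_minus_one norm_minus_cancel norm_one)

lemma cstar_seminorm_nonneg:
  assumes "cstar_seminorm p" shows "0 \<le> p a"
proof -
  have "p (a + - a) \<le> p a + p (- a)"
    using assms by (simp only: cstar_seminorm_def)
  then show ?thesis
    using cstar_seminorm_uminus[OF assms, of a] cstar_seminorm_zero[OF assms] by simp
qed

lemma null_poly_zero: "null_poly 0"
  by (simp add: null_poly_def cstar_seminorm_zero)

lemma null_poly_add:
  assumes "null_poly a" "null_poly b" shows "null_poly (a + b)"
  unfolding null_poly_def
proof (intro allI impI)
  fix p :: "'a ncpoly \<Rightarrow> real"
  assume p: "cstar_seminorm p \<and> magic_relations p"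
  then have "p (a + b) \<le> p a + p b" by (simp add: cstar_seminorm_def)
  moreover have "p a = 0" "p b = 0" "0 \<le> p (a + b)"
    using p assms by (auto simp: null_poly_def cstar_seminorm_nonneg)
  ultimately show "p (a + b) = 0" by simp
qed

lemma null_poly_uminus: "null_poly a \<Longrightarrow> null_poly (- a)"
  by (simp add: null_poly_def cstar_seminorm_uminus)

lemma null_poly_scale: "null_poly a \<Longrightarrow> null_poly (ncscale c a)"
  by (simp add: null_poly_def cstar_seminorm_def)

lemma null_poly_mult_right:
  assumes "null_poly a" shows "null_poly (a * b)"
  unfolding null_poly_def
proof (intro allI impI)
  fix p :: "'a ncpoly \<Rightarrow> real"
  assume p: "cstar_seminorm p \<and> magic_relations p"
  then have "p (a * b) \<le> p a * p b" by (simp add: cstar_seminorm_def)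
  moreover have "p a = 0" "0 \<le> p (a * b)"
    using p assms by (auto simp: null_poly_def cstar_seminorm_nonneg)
  ultimately show "p (a * b) = 0" by simp
qed

lemma null_poly_mult_left:
  assumes "null_poly a" shows "null_poly (b * a)"
  unfolding null_poly_def
proof (intro allI impI)
  fix p :: "'a ncpoly \<Rightarrow> real"
  assume p: "cstar_seminorm p \<and> magic_relations p"
  then have "p (b * a) \<le> p b * p a" by (simp add: cstar_seminorm_def)
  moreover have "p a = 0" "0 \<le> p (b * a)"
    using p assms by (auto simp: null_poly_def cstar_seminorm_nonneg)
  ultimately show "p (b * a) = 0" by simp
qed

lemma null_poly_star:
  assumes "null_poly a" shows "null_poly (ncstar a)"
  unfolding null_poly_def
proof (intro allI impI)
  fix p :: "'a ncpoly \<Rightarrow> real"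
  assume p: "cstar_seminorm p \<and> magic_relations p"
  then have "(p (ncstar a))\<^sup>2 = p (a * ncstar a)"
    by (metis cstar_seminorm_def ncstar_ncstar)
  also have "\<dots> = 0"
    using p null_poly_mult_right[OF assms] by (simp add: null_poly_def)
  finally show "p (ncstar a) = 0" by simp
qed

definition pol_eq :: "'n::finite ncpoly \<Rightarrow> 'n ncpoly \<Rightarrow> bool" where
  "pol_eq a b \<longleftrightarrow> null_poly (a - b)"

quotient_type 'n pol = "'n::finite ncpoly" / pol_eq
proof (rule equivpI)
  show "reflp (pol_eq :: 'n ncpoly \<Rightarrow> _)"
    by (simp add: reflp_def pol_eq_def null_poly_zero)
  show "symp (pol_eq :: 'n ncpoly \<Rightarrow> _)"
    unfolding symp_def pol_eq_def by (metis minus_diff_eq null_poly_uminus)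
  show "transp (pol_eq :: 'n ncpoly \<Rightarrow> _)"
    unfolding transp_def pol_eq_def
  proof (intro allI impI)
    fix a b c :: "'n ncpoly"
    assume "null_poly (a - b)" "null_poly (b - c)"
    then have "null_poly ((a - b) + (b - c))" by (rule null_poly_add)
    then show "null_poly (a - c)" by simp
  qed
qed

instantiation pol :: (finite) star_algebra
begin

lift_definition zero_pol :: "'a pol" is 0 .
lift_definition one_pol :: "'a pol" is 1 .
lift_definition plus_pol :: "'a pol \<Rightarrow> 'a pol \<Rightarrow> 'a pol" is "(+)"
  unfolding pol_eq_def add_diff_add by (rule null_poly_add)
lift_definition uminus_pol :: "'a pol \<Rightarrow> 'a pol" is uminus
  unfolding pol_eq_def minus_diff_minus by (rule null_poly_uminus)
lift_definition minus_pol :: "'a pol \<Rightarrow> 'a pol \<Rightarrow> 'a pol" is "(-)"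
proof -
  fix a b c d :: "'a ncpoly"
  assume "pol_eq a b" "pol_eq c d"
  then have "null_poly ((a - b) + - (c - d))"
    unfolding pol_eq_def by (intro null_poly_add null_poly_uminus)
  then show "pol_eq (a - c) (b - d)"
    by (simp add: pol_eq_def algebra_simps)
qed
lift_definition times_pol :: "'a pol \<Rightarrow> 'a pol \<Rightarrow> 'a pol" is "(*)"
proof -
  fix a b c d :: "'a ncpoly"
  assume "pol_eq a b" "pol_eq c d"
  then have "null_poly ((a - b) * c + b * (c - d))"
    unfolding pol_eq_def by (intro null_poly_add null_poly_mult_left null_poly_mult_right)
  then show "pol_eq (a * c) (b * d)"
    by (simp add: pol_eq_def algebra_simps)
qed
lift_definition scaleC_pol :: "complex \<Rightarrow> 'a pol \<Rightarrow> 'a pol" is ncscale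
  unfolding pol_eq_def ncscale_diff[symmetric] by (rule null_poly_scale)
lift_definition star_pol :: "'a pol \<Rightarrow> 'a pol" is ncstar
  unfolding pol_eq_def ncstar_minus[symmetric] by (rule null_poly_star)

lemma pol_eq_refl: "pol_eq a a"
  by (simp add: pol_eq_def null_poly_zero)

instance
proof
  fix x y z :: "'a pol" and b c :: complex
  note refl = pol_eq_refl
  show "x + y + z = x + (y + z)" by transfer (simp add: algebra_simps refl)
  show "x + y = y + x" by transfer (simp add: algebra_simps refl)
  show "0 + x = x" by transfer (simp add: refl)
  show "- x + x = 0" by transfer (simp add: refl)
  show "x - y = x + - y" by transfer (simp add: refl)
  show "x * y * z = x * (y * z)" by transfer (simp add: algebra_simps refl)
  show "(x + y) * z = x * z + y * z" by transfer (simp add: algebra_simps refl)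
  show "x * (y + z) = x * y + x * z" by transfer (simp add: algebra_simps refl)
  show "1 * x = x" by transfer (simp add: refl)
  show "x * 1 = x" by transfer (simp add: refl)
  show "c *\<^sub>C (x + y) = c *\<^sub>C x + c *\<^sub>C y"
    by transfer (simp add: ncscale_def algebra_simps refl)
  show "(b + c) *\<^sub>C x = b *\<^sub>C x + c *\<^sub>C x"
    by transfer (simp add: ncscale_def single_add algebra_simps refl)
  show "b *\<^sub>C c *\<^sub>C x = (b * c) *\<^sub>C x"
    by transfer (simp add: ncscale_def mult_single refl flip: mult.assoc)
  show "1 *\<^sub>C x = x" by transfer (simp add: ncscale_def refl)
  show "(c *\<^sub>C x) * y = c *\<^sub>C (x * y)"
    by transfer (simp add: ncscale_def algebra_simps refl)
  show "x * (c *\<^sub>C y) = c *\<^sub>C (x * y)"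
    by transfer (simp add: ncscale_mult_right refl)
  show "star (star x) = x" by transfer (simp add: ncstar_ncstar refl)
  show "star (x + y) = star x + star y" by transfer (simp add: ncstar_add refl)
  show "star (x * y) = star y * star x" by transfer (simp add: ncstar_mult refl)
  show "star (c *\<^sub>C x) = cnj c *\<^sub>C star x" by transfer (simp add: ncstar_ncscale refl)
qed

end

lift_definition ugen :: "'n::finite \<Rightarrow> 'n \<Rightarrow> 'n pol" is gen .


section \<open>Algebraic tensor products of *-algebras\<close>

text \<open>The list $[(a_1,b_1),\dots,(a_n,b_n)]$ stands for $\sum_k a_k \otimes b_k$; two such sums
  are equal in the algebraic tensor product iff no bilinear form separates them.\<close>

definition bilinear_form :: "('a::complex_vector \<Rightarrow> 'b::complex_vector \<Rightarrow> complex) \<Rightarrow> bool" where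
  "bilinear_form \<beta> \<longleftrightarrow> (\<forall>b. clinear (\<lambda>a. \<beta> a b)) \<and> (\<forall>a. clinear (\<beta> a))"

definition tensor_eval :: "('a \<Rightarrow> 'b \<Rightarrow> complex) \<Rightarrow> ('a \<times> 'b) list \<Rightarrow> complex" where
  "tensor_eval \<beta> xs = (\<Sum>(a, b)\<leftarrow>xs. \<beta> a b)"

definition tensor_eq ::
    "('a::star_algebra \<times> 'b::star_algebra) list \<Rightarrow> ('a \<times> 'b) list \<Rightarrow> bool" where
  "tensor_eq xs ys \<longleftrightarrow> (\<forall>\<beta>. bilinear_form \<beta> \<longrightarrow> tensor_eval \<beta> xs = tensor_eval \<beta> ys)"

quotient_type (overloaded) ('a, 'b) tensor = "('a::star_algebra \<times> 'b::star_algebra) list" / tensor_eq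
  by (rule equivpI) (auto simp: reflp_def symp_def transp_def tensor_eq_def)

definition list_mult :: "('a::star_algebra \<times> 'b::star_algebra) list \<Rightarrow> ('a \<times> 'b) list \<Rightarrow> ('a \<times> 'b) list"
  where "list_mult xs ys = concat (map (\<lambda>(a, b). map (\<lambda>(c, d). (a * c, b * d)) ys) xs)"

lemma tensor_eval_simps [simp]:
  "tensor_eval \<beta> [] = 0"
  "tensor_eval \<beta> ((a, b) # xs) = \<beta> a b + tensor_eval \<beta> xs"
  "tensor_eval \<beta> (xs @ ys) = tensor_eval \<beta> xs + tensor_eval \<beta> ys"
  by (simp_all add: tensor_eval_def)

lemma list_mult_simps [simp]:
  "list_mult [] ys = []"
  "list_mult ((a, b) # xs) ys = map (\<lambda>(c, d). (a * c, b * d)) ys @ list_mult xs ys"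
  by (simp_all add: list_mult_def)

lemma tensor_eval_map:
  "tensor_eval \<beta> (map (\<lambda>(a, b). (f a, g b)) xs) = tensor_eval (\<lambda>a b. \<beta> (f a) (g b)) xs"
  by (induction xs) auto

lemma tensor_eval_add_fun:
  "tensor_eval (\<lambda>a b. \<beta> a b + \<gamma> a b) xs = tensor_eval \<beta> xs + tensor_eval \<gamma> xs"
  by (induction xs) (auto simp: algebra_simps)

lemma tensor_eval_list_mult:
  "tensor_eval \<beta> (list_mult xs ys) =
     tensor_eval (\<lambda>a b. tensor_eval (\<lambda>c d. \<beta> (a * c) (b * d)) ys) xs"
  by (induction xs) (auto simp: tensor_eval_map)

lemma tensor_eval_list_mult_swap:
  "tensor_eval \<beta> (list_mult xs ys) =
     tensor_eval (\<lambda>c d. tensor_eval (\<lambda>a b. \<beta> (a * c) (b * d)) xs) ys"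
  by (induction xs) (auto simp: tensor_eval_map tensor_eval_add_fun, induction ys, auto)

lemma tensor_eval_scale: "tensor_eval (\<lambda>a b. k * \<beta> a b) xs = k * tensor_eval \<beta> xs"
  by (induction xs) (auto simp: algebra_simps)

lemma tensor_eval_cnj: "tensor_eval (\<lambda>a b. cnj (\<beta> a b)) xs = cnj (tensor_eval \<beta> xs)"
  by (induction xs) auto

lemma bilinear_form_iff:
  "bilinear_form \<beta> \<longleftrightarrow>
     (\<forall>a a' b. \<beta> (a + a') b = \<beta> a b + \<beta> a' b) \<and> (\<forall>c a b. \<beta> (c *\<^sub>C a) b = c * \<beta> a b) \<and>
     (\<forall>a b b'. \<beta> a (b + b') = \<beta> a b + \<beta> a b') \<and> (\<forall>c a b. \<beta> a (c *\<^sub>C b) = c * \<beta> a b)"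
  by (auto simp: bilinear_form_def clinear_def scaleC_complex_def)

lemma bilinear_form_mult_left:
  fixes \<beta> :: "'a::star_algebra \<Rightarrow> 'b::star_algebra \<Rightarrow> complex"
  assumes "bilinear_form \<beta>"
  shows "bilinear_form (\<lambda>a b. tensor_eval (\<lambda>c d. \<beta> (a * c) (b * d)) ys)"
  using assms unfolding bilinear_form_iff
  by (simp add: algebra_simps mult_scaleC_left tensor_eval_add_fun tensor_eval_scale)

lemma bilinear_form_mult_right:
  fixes \<beta> :: "'a::star_algebra \<Rightarrow> 'b::star_algebra \<Rightarrow> complex"
  assumes "bilinear_form \<beta>"
  shows "bilinear_form (\<lambda>c d. tensor_eval (\<lambda>a b. \<beta> (a * c) (b * d)) xs)"
  using assms unfolding bilinear_form_iff
  by (simp add: algebra_simps mult_scaleC_right tensor_eval_add_fun tensor_eval_scale)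

lemma bilinear_form_star:
  fixes \<beta> :: "'a::star_algebra \<Rightarrow> 'b::star_algebra \<Rightarrow> complex"
  assumes "bilinear_form \<beta>"
  shows "bilinear_form (\<lambda>a b. cnj (\<beta> (star a) (star b)))"
  using assms unfolding bilinear_form_iff by (simp add: star_add star_scaleC)

lemma bilinear_form_minus:
  assumes "bilinear_form \<beta>" shows "\<beta> (- a) b = - \<beta> a b"
  using assms unfolding bilinear_form_iff
  by (metis add.right_inverse add_eq_0_iff add_cancel_right_right)

lemma tensor_eval_minus:
  assumes "bilinear_form \<beta>"
  shows "tensor_eval \<beta> (map (\<lambda>(a, b). (- a, b)) xs) = - tensor_eval \<beta> xs"
  by (induction xs) (auto simp: bilinear_form_minus[OF assms])

lemma tensor_eval_scaleC:
  assumes "bilinear_form \<beta>"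
  shows "tensor_eval \<beta> (map (\<lambda>(a, b). (c *\<^sub>C a, b)) xs) = c * tensor_eval \<beta> xs"
  using assms by (induction xs) (auto simp: bilinear_form_iff algebra_simps)

lemma tensor_eval_star:
  "tensor_eval \<beta> (map (\<lambda>(a, b). (star a, star b)) xs) =
     cnj (tensor_eval (\<lambda>a b. cnj (\<beta> (star a) (star b))) xs)"
  by (induction xs) auto

instantiation tensor :: (star_algebra, star_algebra) star_algebra
begin

lift_definition zero_tensor :: "('a, 'b) tensor" is "[]" .
lift_definition one_tensor :: "('a, 'b) tensor" is "[(1, 1)]" .
lift_definition plus_tensor :: "('a, 'b) tensor \<Rightarrow> ('a, 'b) tensor \<Rightarrow> ('a, 'b) tensor" is "(@)"
  by (simp add: tensor_eq_def)
lift_definition uminus_tensor :: "('a, 'b) tensor \<Rightarrow> ('a, 'b) tensor"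
  is "map (\<lambda>(a, b). (- a, b))"
  by (simp add: tensor_eq_def tensor_eval_minus)
lift_definition minus_tensor :: "('a, 'b) tensor \<Rightarrow> ('a, 'b) tensor \<Rightarrow> ('a, 'b) tensor"
  is "\<lambda>xs ys. xs @ map (\<lambda>(a, b). (- a, b)) ys"
  by (simp add: tensor_eq_def tensor_eval_minus)
lift_definition times_tensor :: "('a, 'b) tensor \<Rightarrow> ('a, 'b) tensor \<Rightarrow> ('a, 'b) tensor"
  is list_mult
proof -
  fix xs xs' ys ys' :: "('a \<times> 'b) list"
  assume x: "tensor_eq xs xs'" and y: "tensor_eq ys ys'"
  show "tensor_eq (list_mult xs ys) (list_mult xs' ys')"
    unfolding tensor_eq_def
  proof (intro allI impI)
    fix \<beta> :: "'a \<Rightarrow> 'b \<Rightarrow> complex"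
    assume \<beta>: "bilinear_form \<beta>"
    have "tensor_eval \<beta> (list_mult xs ys) = tensor_eval \<beta> (list_mult xs' ys)"
      using x bilinear_form_mult_left[OF \<beta>] by (simp add: tensor_eval_list_mult tensor_eq_def)
    also have "\<dots> = tensor_eval \<beta> (list_mult xs' ys')"
      using y bilinear_form_mult_right[OF \<beta>]
      by (simp add: tensor_eval_list_mult_swap tensor_eq_def)
    finally show "tensor_eval \<beta> (list_mult xs ys) = tensor_eval \<beta> (list_mult xs' ys')" .
  qed
qed
lift_definition scaleC_tensor :: "complex \<Rightarrow> ('a, 'b) tensor \<Rightarrow> ('a, 'b) tensor"
  is "\<lambda>c. map (\<lambda>(a, b). (c *\<^sub>C a, b))"
  by (simp add: tensor_eq_def tensor_eval_scaleC)
lift_definition star_tensor :: "('a, 'b) tensor \<Rightarrow> ('a, 'b) tensor"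
  is "map (\<lambda>(a, b). (star a, star b))"
  by (simp add: tensor_eq_def tensor_eval_star bilinear_form_star)

instance
proof
  fix x y z :: "('a, 'b) tensor" and b c :: complex
  note ev = tensor_eq_def tensor_eval_minus tensor_eval_scaleC tensor_eval_star
    bilinear_form_star tensor_eval_list_mult
  show "x + y + z = x + (y + z)" by transfer (simp add: ev)
  show "x + y = y + x" by transfer (simp add: ev)
  show "0 + x = x" by transfer (simp add: ev)
  show "- x + x = 0" by transfer (simp add: ev)
  show "x - y = x + - y" by transfer (simp add: ev)
  show "x * y * z = x * (y * z)"
    by transfer (simp add: ev mult.assoc)
  show "(x + y) * z = x * z + y * z" by transfer (simp add: ev)
  show "x * (y + z) = x * y + x * z" by transfer (simp add: ev tensor_eval_add_fun)
  show "1 * x = x" by transfer (simp add: ev)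
  show "x * 1 = x" by transfer (simp add: ev)
  show "c *\<^sub>C (x + y) = c *\<^sub>C x + c *\<^sub>C y" by transfer (simp add: ev algebra_simps)
  show "(b + c) *\<^sub>C x = b *\<^sub>C x + c *\<^sub>C x" by transfer (simp add: ev algebra_simps)
  show "b *\<^sub>C c *\<^sub>C x = (b * c) *\<^sub>C x"
    by transfer (simp add: ev del: map_map)
  show "1 *\<^sub>C x = x" by transfer (simp add: ev)
  show "(c *\<^sub>C x) * y = c *\<^sub>C (x * y)"
    by transfer (simp add: tensor_eq_def tensor_eval_scaleC tensor_eval_list_mult
        bilinear_form_mult_left)
  show "x * (c *\<^sub>C y) = c *\<^sub>C (x * y)"
    by transfer (simp add: tensor_eq_def tensor_eval_scaleC tensor_eval_list_mult_swap
        bilinear_form_mult_right)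
  show "star (star x) = x" by transfer (simp add: ev star_star del: map_map)
  show "star (x + y) = star x + star y" by transfer (simp add: ev)
  show "star (x * y) = star y * star x"
  proof transfer
    fix xs ys :: "('a \<times> 'b) list"
    have "tensor_eval \<beta> (map (\<lambda>(a, b). (star a, star b)) (list_mult xs ys)) =
        tensor_eval \<beta> (list_mult (map (\<lambda>(a, b). (star a, star b)) ys)
          (map (\<lambda>(a, b). (star a, star b)) xs))" for \<beta>
      unfolding tensor_eval_map tensor_eval_list_mult_swap[of _ xs]
      by (simp add: tensor_eval_list_mult tensor_eval_map star_mult)
    then show "tensor_eq (map (\<lambda>(a, b). (star a, star b)) (list_mult xs ys))
        (list_mult (map (\<lambda>(a, b). (star a, star b)) ys) (map (\<lambda>(a, b). (star a, star b)) xs))"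
      by (simp add: tensor_eq_def)
  qed
  show "star (c *\<^sub>C x) = cnj c *\<^sub>C star x"
    by transfer (simp add: tensor_eq_def star_scaleC comp_def split_def)
qed

end

lift_definition tensor :: "'a::star_algebra \<Rightarrow> 'b::star_algebra \<Rightarrow> ('a, 'b) tensor"
  (infixl "\<otimes>" 72) is "\<lambda>a b. [(a, b)]" .


section \<open>Comultiplication, Haar state and corepresentations\<close>

type_synonym 'n coproduct = "'n pol \<Rightarrow> ('n pol, 'n pol) tensor"

definition comultiplication :: "'n::finite coproduct \<Rightarrow> bool" where
  "comultiplication \<Delta> \<longleftrightarrow> unital_star_hom \<Delta> \<and>
     (\<forall>i j. \<Delta> (ugen i j) = (\<Sum>k\<in>UNIV. ugen i k \<otimes> ugen k j))"

text \<open>Invariance reads $(\mathrm{id}\otimes h)\Delta(x) = h(x)1 = (h\otimes\mathrm{id})\Delta(x)$,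
  evaluated on a decomposition of $\Delta(x)$ into elementary tensors; for linear $h$ the slices do
  not depend on the decomposition.\<close>

definition haar_state :: "'n::finite coproduct \<Rightarrow> ('n pol \<Rightarrow> complex) \<Rightarrow> bool" where
  "haar_state \<Delta> h \<longleftrightarrow> clinear h \<and> h 1 = 1 \<and> (\<forall>x. 0 \<le> h (star x * x)) \<and>
     (\<forall>x xs. \<Delta> x = (\<Sum>(a, b)\<leftarrow>xs. a \<otimes> b) \<longrightarrow>
        (\<Sum>(a, b)\<leftarrow>xs. h b *\<^sub>C a) = h x *\<^sub>C 1 \<and>
        (\<Sum>(a, b)\<leftarrow>xs. h a *\<^sub>C b) = h x *\<^sub>C 1)"

definition norm2 :: "('n::finite pol \<Rightarrow> complex) \<Rightarrow> 'n pol \<Rightarrow> real" where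
  "norm2 h x = sqrt (Re (h (star x * x)))"

text \<open>A finite-dimensional corepresentation is a square matrix over \<open>Pol\<close> indexed by a finite
  set \<open>I\<close>; entries outside \<open>I \<times> I\<close> are irrelevant.\<close>

definition unitary_corep ::
    "'n::finite coproduct \<Rightarrow> 'i set \<Rightarrow> ('i \<Rightarrow> 'i \<Rightarrow> 'n pol) \<Rightarrow> bool" where
  "unitary_corep \<Delta> I v \<longleftrightarrow> finite I \<and>
     (\<forall>i\<in>I. \<forall>j\<in>I. \<Delta> (v i j) = (\<Sum>k\<in>I. v i k \<otimes> v k j)) \<and>
     (\<forall>i\<in>I. \<forall>j\<in>I. (\<Sum>k\<in>I. star (v k i) * v k j) = (if i = j then 1 else 0)) \<and>
     (\<forall>i\<in>I. \<forall>j\<in>I. (\<Sum>k\<in>I. v i k * star (v j k)) = (if i = j then 1 else 0))"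

text \<open>\<open>T\<close> is a \<open>J \<times> I\<close> matrix with $T v = w T$.\<close>

definition intertwiner ::
    "'i set \<Rightarrow> ('i \<Rightarrow> 'i \<Rightarrow> 'n::finite pol) \<Rightarrow> 'j set \<Rightarrow> ('j \<Rightarrow> 'j \<Rightarrow> 'n pol) \<Rightarrow>
     ('j \<Rightarrow> 'i \<Rightarrow> complex) \<Rightarrow> bool" where
  "intertwiner I v J w T \<longleftrightarrow>
     (\<forall>j\<in>J. \<forall>i\<in>I. (\<Sum>k\<in>I. T j k *\<^sub>C v k i) = (\<Sum>l\<in>J. T l i *\<^sub>C w j l))"

definition corep_equiv ::
    "'i set \<Rightarrow> ('i \<Rightarrow> 'i \<Rightarrow> 'n::finite pol) \<Rightarrow> 'j set \<Rightarrow> ('j \<Rightarrow> 'j \<Rightarrow> 'n pol) \<Rightarrow> bool" where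
  "corep_equiv I v J w \<longleftrightarrow> (\<exists>T S. intertwiner I v J w T \<and>
     (\<forall>i\<in>I. \<forall>i'\<in>I. (\<Sum>j\<in>J. S i j * T j i') = (if i = i' then 1 else 0)) \<and>
     (\<forall>j\<in>J. \<forall>j'\<in>J. (\<Sum>i\<in>I. T j i * S i j') = (if j = j' then 1 else 0)))"

definition irreducible_corep ::
    "'n::finite coproduct \<Rightarrow> 'i set \<Rightarrow> ('i \<Rightarrow> 'i \<Rightarrow> 'n pol) \<Rightarrow> bool" where
  "irreducible_corep \<Delta> I v \<longleftrightarrow> unitary_corep \<Delta> I v \<and> I \<noteq> {} \<and>
     (\<forall>T. intertwiner I v I v T \<longrightarrow>
        (\<exists>c. \<forall>i\<in>I. \<forall>j\<in>I. T i j = (if i = j then c else 0)))"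

fun corep_sum ::
    "('i \<Rightarrow> 'i \<Rightarrow> 'n::finite pol) \<Rightarrow> ('j \<Rightarrow> 'j \<Rightarrow> 'n pol) \<Rightarrow> 'i + 'j \<Rightarrow> 'i + 'j \<Rightarrow> 'n pol" where
  "corep_sum v w (Inl i) (Inl i') = v i i'"
| "corep_sum v w (Inr j) (Inr j') = w j j'"
| "corep_sum v w (Inl i) (Inr j) = 0"
| "corep_sum v w (Inr j) (Inl i) = 0"

definition corep_tensor ::
    "('i \<Rightarrow> 'i \<Rightarrow> 'n::finite pol) \<Rightarrow> ('j \<Rightarrow> 'j \<Rightarrow> 'n pol) \<Rightarrow> 'i \<times> 'j \<Rightarrow> 'i \<times> 'j \<Rightarrow> 'n pol" where
  "corep_tensor v w = (\<lambda>(i, j) (i', j'). v i i' * w j j')"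

definition coeff_space :: "'i set \<Rightarrow> ('i \<Rightarrow> 'i \<Rightarrow> 'n::finite pol) \<Rightarrow> 'n pol set" where
  "coeff_space I v = range (\<lambda>c. \<Sum>i\<in>I. \<Sum>j\<in>I. c i j *\<^sub>C v i j)"


section \<open>The irreducible corepresentations $u^{(s)}$ and the heat generator\<close>

definition chebyshev_U :: "nat \<Rightarrow> real poly" where
  "chebyshev_U s = (\<Sum>p\<le>s div 2. monom ((-1) ^ p * of_nat ((s - p) choose p)) (s - 2 * p))"

text \<open>\<open>v s\<close>, a matrix indexed by \<open>{..<d s}\<close>, is a unitary representative of $u^{(s)}$.\<close>

definition irreducible_series ::
    "'n::finite coproduct \<Rightarrow> (nat \<Rightarrow> nat) \<Rightarrow> (nat \<Rightarrow> nat \<Rightarrow> nat \<Rightarrow> 'n pol) \<Rightarrow> bool" where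
  "irreducible_series \<Delta> d v \<longleftrightarrow>
     (\<forall>s. irreducible_corep \<Delta> {..<d s} (v s)) \<and>
     (\<forall>r s. corep_equiv {..<d r} (v r) {..<d s} (v s) \<longrightarrow> r = s) \<and>
     (\<forall>n (w :: nat \<Rightarrow> nat \<Rightarrow> 'n pol). irreducible_corep \<Delta> {..<n} w \<longrightarrow>
        (\<exists>s. corep_equiv {..<n} w {..<d s} (v s))) \<and>
     d 0 = 1 \<and> v 0 0 0 = 1 \<and>
     corep_equiv UNIV (ugen :: 'n \<Rightarrow> 'n \<Rightarrow> 'n pol)
       ({..<d 0} <+> {..<d 1}) (corep_sum (v 0) (v 1)) \<and>
     (\<forall>s\<ge>1. corep_equiv
        ({..<d 1} \<times> {..<d s}) (corep_tensor (v 1) (v s))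
        ({..<d (s + 1)} <+> ({..<d s} <+> {..<d (s - 1)}))
        (corep_sum (v (s + 1)) (corep_sum (v s) (v (s - 1))))) \<and>
     (\<forall>s. real (d s) = poly (chebyshev_U (2 * s)) (sqrt (real CARD('n))))"

definition heat_eigenvalue :: "nat \<Rightarrow> nat \<Rightarrow> real" where
  "heat_eigenvalue N s =
     - (poly (pderiv (chebyshev_U (2 * s))) (sqrt (real N)) /
        (2 * sqrt (real N) * poly (chebyshev_U (2 * s)) (sqrt (real N))))"

definition heat_generator ::
    "(nat \<Rightarrow> nat) \<Rightarrow> (nat \<Rightarrow> nat \<Rightarrow> nat \<Rightarrow> 'n::finite pol) \<Rightarrow> ('n pol \<Rightarrow> 'n pol) \<Rightarrow> bool" where
  "heat_generator d v L \<longleftrightarrow> clinear L \<and>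
     (\<forall>s. \<forall>x\<in>coeff_space {..<d s} (v s).
        L x = complex_of_real (heat_eigenvalue CARD('n) s) *\<^sub>C x)"


section \<open>The GNS representation and positive elements\<close>

definition bounded_op :: "('h::complex_hilbert_space \<Rightarrow> 'h) \<Rightarrow> bool" where
  "bounded_op T \<longleftrightarrow> clinear T \<and> (\<exists>K. \<forall>\<xi>. norm (T \<xi>) \<le> K * norm \<xi>)"

text \<open>\<open>\<Lambda>\<close> is the canonical map $x \mapsto \pi(x)\Omega$ into the GNS Hilbert space of \<open>h\<close>.\<close>

definition gns_representation ::
    "('n::finite pol \<Rightarrow> complex) \<Rightarrow> ('n pol \<Rightarrow> 'h::complex_hilbert_space) \<Rightarrow>
     ('n pol \<Rightarrow> 'h \<Rightarrow> 'h) \<Rightarrow> bool" where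
  "gns_representation h \<Lambda> \<pi> \<longleftrightarrow>
     clinear \<Lambda> \<and> closure (range \<Lambda>) = UNIV \<and>
     (\<forall>x y. cinner (\<Lambda> x) (\<Lambda> y) = h (star x * y)) \<and>
     (\<forall>x. bounded_op (\<pi> x)) \<and> (\<forall>x y. \<pi> x (\<Lambda> y) = \<Lambda> (x * y))"

definition commutant :: "('h::complex_hilbert_space \<Rightarrow> 'h) set \<Rightarrow> ('h \<Rightarrow> 'h) set" where
  "commutant M = {S. bounded_op S \<and> (\<forall>T\<in>M. S \<circ> T = T \<circ> S)}"

text \<open>The von Neumann algebra generated by the unital *-algebra $\pi(\mathrm{Pol})$.\<close>

definition Linf :: "('n::finite pol \<Rightarrow> 'h::complex_hilbert_space \<Rightarrow> 'h) \<Rightarrow> ('h \<Rightarrow> 'h) set" where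
  "Linf \<pi> = commutant (commutant (range \<pi>))"

text \<open>\<open>S\<close> is the absolute value $|T| = (T^*T)^{1/2}$ of \<open>T\<close> in the von Neumann algebra \<open>M\<close>:
  the (unique) positive element of \<open>M\<close> whose square is $T^*T$.\<close>

definition is_abs_value ::
    "('h::complex_hilbert_space \<Rightarrow> 'h) set \<Rightarrow> ('h \<Rightarrow> 'h) \<Rightarrow> ('h \<Rightarrow> 'h) \<Rightarrow> bool" where
  "is_abs_value M T S \<longleftrightarrow> S \<in> M \<and> (\<forall>\<xi>. 0 \<le> cinner \<xi> (S \<xi>)) \<and>
     (\<exists>T'\<in>M. (\<forall>\<xi> \<eta>. cinner (T' \<xi>) \<eta> = cinner \<xi> (T \<eta>)) \<and> S \<circ> S = T' \<circ> T)"

text \<open>The elements with $|x| = x$.\<close>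

definition pol_pos :: "('n::finite pol \<Rightarrow> 'h::complex_hilbert_space \<Rightarrow> 'h) \<Rightarrow> 'n pol set" where
  "pol_pos \<pi> = {x. is_abs_value (Linf \<pi>) (\<pi> x) (\<pi> x)}"

end

theory Submission
  imports Defs
begin

text \<open>Each \<open>V\<^sub>s\<close> is an eigenspace of the generator, so with \<open>x = \<Sum>\<^sub>s x\<^sub>s\<close>, \<open>x\<^sub>s \<in> V\<^sub>s\<close>, where \<open>T\<^sub>L x\<^sub>s = \<lambda>\<^sub>s x\<^sub>s\<close>,
  everything reduces to Schur orthogonality \<open>h(x\<^sub>r\<^sup>* x\<^sub>s) = 0\<close> for \<open>r \<noteq> s\<close> and to the bound \<open>- \<lambda>\<^sub>s \<ge> 1/N\<close> for \<open>s \<ge> 1\<close>.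
  The former holds because invariance of the Haar state makes the matrix
  \<open>(h(v\<^sub>k\<^sub>p\<^sup>* w\<^sub>l\<^sub>q))\<^sub>p\<^sub>q\<close> an intertwiner between irreducible corepresentations. The latter follows from
  \<open>X U\<^sub>n'(X) \<ge> n U\<^sub>n(X)\<close> for \<open>X \<ge> 2\<close>: the difference \<open>D\<^sub>n\<close> of the two sides satisfies
  \<open>D\<^sub>n\<^sub>+\<^sub>1 = X D\<^sub>n - D\<^sub>n\<^sub>-\<^sub>1 + 2 U\<^sub>n\<^sub>-\<^sub>1\<close>, and
  \<open>D\<^sub>0 = D\<^sub>1 = 0\<close>, so it is increasing in \<open>n\<close>. Positivity of \<open>x\<close> is used only through
  \<open>h(x z) = h(x\<^sup>* z)\<close>.\<close>

section \<open>Complex linear algebra\<close>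

lemma scaleC_zero_left [simp]: "0 *\<^sub>C x = (0 :: 'a::complex_vector)"
  using scaleC_add_left[of 0 0 x] by simp

lemma scaleC_zero_right [simp]: "c *\<^sub>C 0 = (0 :: 'a::complex_vector)"
  using scaleC_add_right[of c 0 0] by simp

lemma scaleC_sum_right: "c *\<^sub>C (\<Sum>a\<in>A. f a) = (\<Sum>a\<in>A. c *\<^sub>C (f a :: 'a::complex_vector))"
  by (induction A rule: infinite_finite_induct) (simp_all add: scaleC_add_right)

lemma scaleC_sum_left: "(\<Sum>a\<in>A. f a) *\<^sub>C x = (\<Sum>a\<in>A. f a *\<^sub>C (x :: 'a::complex_vector))"
  by (induction A rule: infinite_finite_induct) (simp_all add: scaleC_add_left)

lemma clinear_zero: "clinear f \<Longrightarrow> f 0 = 0"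
  unfolding clinear_def by (metis add_cancel_right_right)

lemma clinear_sum: "clinear f \<Longrightarrow> f (\<Sum>a\<in>A. g a) = (\<Sum>a\<in>A. f (g a))"
  by (induction A rule: infinite_finite_induct) (simp_all add: clinear_zero, simp add: clinear_def)

lemma sum_scaleC_delta:
  assumes "finite A" "a \<in> A"
  shows "(\<Sum>b\<in>A. (if a = b then 1 else 0) *\<^sub>C f b) = (f a :: 'a::complex_vector)"
proof -
  have "(\<Sum>b\<in>A. (if a = b then 1 else 0) *\<^sub>C f b) = (\<Sum>b\<in>A. if a = b then f b else 0)"
    by (intro sum.cong) (simp_all add: scaleC_one)
  then show ?thesis using assms by simp
qed

lemma star_zero [simp]: "star 0 = (0 :: 'a::star_algebra)"
  using star_add[of 0 "0 :: 'a"] by simp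

lemma star_one [simp]: "star 1 = (1 :: 'a::star_algebra)"
  by (metis mult_1 mult_1_right star_mult star_star)

lemma star_sum: "star (\<Sum>a\<in>A. f a) = (\<Sum>a\<in>A. star (f a :: 'a::star_algebra))"
  by (induction A rule: infinite_finite_induct) (simp_all add: star_add)

lemma tensor_mult: "(a \<otimes> b) * (c \<otimes> d) = (a * c) \<otimes> (b * d)"
  by transfer (simp add: tensor_eq_def)

lemma tensor_star: "star (a \<otimes> b) = star a \<otimes> star b"
  by transfer (simp add: tensor_eq_def)


section \<open>Schur orthogonality\<close>

lemma intertwiner_compose:
  assumes "finite I" "finite J" "finite K"
    and T: "intertwiner I u J v T" and S: "intertwiner J v K w S"
  shows "intertwiner I u K w (\<lambda>k i. \<Sum>j\<in>J. S k j * T j i)"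
  unfolding intertwiner_def
proof (intro ballI)
  fix k i assume k: "k \<in> K" and i: "i \<in> I"
  have "(\<Sum>a\<in>I. (\<Sum>j\<in>J. S k j * T j a) *\<^sub>C u a i) =
      (\<Sum>a\<in>I. \<Sum>j\<in>J. S k j *\<^sub>C T j a *\<^sub>C u a i)"
    by (simp add: scaleC_sum_left scaleC_scaleC)
  also have "\<dots> = (\<Sum>j\<in>J. S k j *\<^sub>C (\<Sum>a\<in>I. T j a *\<^sub>C u a i))"
    by (subst sum.swap) (simp add: scaleC_sum_right)
  also have "\<dots> = (\<Sum>j\<in>J. S k j *\<^sub>C (\<Sum>l\<in>J. T l i *\<^sub>C v j l))"
    using T i by (intro sum.cong) (simp_all add: intertwiner_def)
  also have "\<dots> = (\<Sum>l\<in>J. T l i *\<^sub>C (\<Sum>j\<in>J. S k j *\<^sub>C v j l))"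
    by (simp add: scaleC_sum_right scaleC_scaleC mult.commute) (rule sum.swap)
  also have "\<dots> = (\<Sum>l\<in>J. T l i *\<^sub>C (\<Sum>b\<in>K. S b l *\<^sub>C w k b))"
    using S k by (intro sum.cong) (simp_all add: intertwiner_def)
  also have "\<dots> = (\<Sum>b\<in>K. (\<Sum>j\<in>J. S b j * T j i) *\<^sub>C w k b)"
    by (simp add: scaleC_sum_right scaleC_sum_left scaleC_scaleC mult.commute) (rule sum.swap)
  finally show "(\<Sum>a\<in>I. (\<Sum>j\<in>J. S k j * T j a) *\<^sub>C u a i) =
      (\<Sum>b\<in>K. (\<Sum>j\<in>J. S b j * T j i) *\<^sub>C w k b)" .
qed

text \<open>Unitarity moves the corepresentations across \<open>T\<close>: from
  \<open>T v = w T\<close> and \<open>w^* w = 1\<close> follows \<open>w^* T v = T\<close> (the fact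
  \<open>1\<close>), and then \<open>v v^* = 1\<close> gives \<open>w^* T = T v^*\<close>. Applying
  \<open>star\<close> to each entry yields \<open>T^* w = v T^*\<close>.\<close>

lemma intertwiner_adjoint:
  assumes v: "unitary_corep \<Delta> I v" and w: "unitary_corep \<Delta> J w"
    and T: "intertwiner I v J w T"
  shows "intertwiner J w I v (\<lambda>i j. cnj (T j i))"
  unfolding intertwiner_def
proof (intro ballI)
  fix n m assume n: "n \<in> I" and m: "m \<in> J"
  have fin: "finite I" "finite J" using v w by (auto simp: unitary_corep_def)
  have 1: "(\<Sum>j\<in>J. \<Sum>k\<in>I. T j k *\<^sub>C (star (w j m) * v k i)) = T m i *\<^sub>C 1" if i: "i \<in> I" for i
  proof -
    have "(\<Sum>j\<in>J. \<Sum>k\<in>I. T j k *\<^sub>C (star (w j m) * v k i)) =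
        (\<Sum>j\<in>J. star (w j m) * (\<Sum>k\<in>I. T j k *\<^sub>C v k i))"
      by (simp add: sum_distrib_left mult_scaleC_right)
    also have "\<dots> = (\<Sum>j\<in>J. star (w j m) * (\<Sum>l\<in>J. T l i *\<^sub>C w j l))"
      using T i by (intro sum.cong) (simp_all add: intertwiner_def)
    also have "\<dots> = (\<Sum>l\<in>J. T l i *\<^sub>C (\<Sum>j\<in>J. star (w j m) * w j l))"
      by (simp add: sum_distrib_left mult_scaleC_right scaleC_sum_right) (rule sum.swap)
    also have "\<dots> = (\<Sum>l\<in>J. if m = l then T l i *\<^sub>C 1 else 0)"
      using w m by (intro sum.cong) (simp_all add: unitary_corep_def)
    finally show ?thesis using fin m by simp
  qed
  have "(\<Sum>j\<in>J. T j n *\<^sub>C star (w j m)) =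
      (\<Sum>j\<in>J. \<Sum>k\<in>I. T j k *\<^sub>C (star (w j m) * (\<Sum>i\<in>I. v k i * star (v n i))))"
  proof (rule sum.cong)
    fix j assume "j \<in> J"
    have "(\<Sum>k\<in>I. T j k *\<^sub>C (star (w j m) * (\<Sum>i\<in>I. v k i * star (v n i)))) =
        (\<Sum>k\<in>I. if k = n then T j k *\<^sub>C star (w j m) else 0)"
      using v n by (intro sum.cong) (simp_all add: unitary_corep_def)
    then show "T j n *\<^sub>C star (w j m) =
        (\<Sum>k\<in>I. T j k *\<^sub>C (star (w j m) * (\<Sum>i\<in>I. v k i * star (v n i))))"
      using fin n by simp
  qed simp
  also have "\<dots> = (\<Sum>j\<in>J. \<Sum>k\<in>I. \<Sum>i\<in>I. T j k *\<^sub>C (star (w j m) * v k i) * star (v n i))"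
    by (simp add: sum_distrib_left scaleC_sum_right mult_scaleC_left mult.assoc)
  also have "\<dots> = (\<Sum>j\<in>J. \<Sum>i\<in>I. \<Sum>k\<in>I. T j k *\<^sub>C (star (w j m) * v k i) * star (v n i))"
    by (rule sum.cong[OF refl]) (rule sum.swap)
  also have "\<dots> = (\<Sum>i\<in>I. \<Sum>j\<in>J. \<Sum>k\<in>I. T j k *\<^sub>C (star (w j m) * v k i) * star (v n i))"
    by (rule sum.swap)
  also have "\<dots> = (\<Sum>i\<in>I. (\<Sum>j\<in>J. \<Sum>k\<in>I. T j k *\<^sub>C (star (w j m) * v k i)) * star (v n i))"
    by (simp add: sum_distrib_right)
  also have "\<dots> = (\<Sum>i\<in>I. T m i *\<^sub>C star (v n i))"
    using 1 by (intro sum.cong) (simp_all add: mult_scaleC_left)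
  finally have "star (\<Sum>j\<in>J. T j n *\<^sub>C star (w j m)) = star (\<Sum>i\<in>I. T m i *\<^sub>C star (v n i))"
    by simp
  then show "(\<Sum>k\<in>J. cnj (T k n) *\<^sub>C w k m) = (\<Sum>l\<in>I. cnj (T m l) *\<^sub>C v n l)"
    by (simp add: star_sum star_scaleC star_star)
qed

lemma irreducible_corep_scalarE:
  assumes "irreducible_corep \<Delta> I v" "intertwiner I v I v T"
  obtains c where "\<And>i j. i \<in> I \<Longrightarrow> j \<in> I \<Longrightarrow> T i j = (if i = j then c else 0)"
  using assms unfolding irreducible_corep_def by blast

text \<open>Irreducibility makes \<open>T^* T\<close> and \<open>T T^*\<close> scalar matrices
  \<open>c\<close> and \<open>c'\<close>. If some entry of \<open>T\<close> is nonzero, the two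
  scalars agree and are nonzero, so that \<open>T^* / c\<close> is a two-sided inverse of
  \<open>T\<close> and the corepresentations are equivalent.\<close>

lemma schur:
  assumes v: "irreducible_corep \<Delta> I v" and w: "irreducible_corep \<Delta> J w"
    and T: "intertwiner I v J w T" and neq: "\<not> corep_equiv I v J w"
    and "i \<in> I" "j \<in> J"
  shows "T j i = 0"
proof (rule ccontr)
  assume nz: "T j i \<noteq> 0"
  have uv: "unitary_corep \<Delta> I v" and uw: "unitary_corep \<Delta> J w"
    using v w by (auto simp: irreducible_corep_def)
  have fin: "finite I" "finite J" using uv uw by (auto simp: unitary_corep_def)
  let ?S = "\<lambda>i j. cnj (T j i)"
  have S: "intertwiner J w I v ?S" by (rule intertwiner_adjoint[OF uv uw T])
  obtain c where c: "\<And>a b. a \<in> I \<Longrightarrow> b \<in> I \<Longrightarrow>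
      (\<Sum>j\<in>J. ?S a j * T j b) = (if a = b then c else 0)"
    by (rule irreducible_corep_scalarE[OF v intertwiner_compose[OF fin(1,2,1) T S]]) blast
  obtain c' where c': "\<And>a b. a \<in> J \<Longrightarrow> b \<in> J \<Longrightarrow>
      (\<Sum>i\<in>I. T a i * ?S i b) = (if a = b then c' else 0)"
    by (rule irreducible_corep_scalarE[OF w intertwiner_compose[OF fin(2,1,2) S T]]) blast
  have "c = (\<Sum>j\<in>J. complex_of_real ((cmod (T j i))\<^sup>2))"
    using c[of i i] \<open>i \<in> I\<close> by (simp add: complex_norm_square mult.commute del: of_real_power)
  also have "\<dots> = complex_of_real (\<Sum>j\<in>J. (cmod (T j i))\<^sup>2)" by simp
  finally have c_eq: "c = complex_of_real (\<Sum>j\<in>J. (cmod (T j i))\<^sup>2)" .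
  \<comment> \<open>The diagonal entry \<open>c\<close> of \<open>T^* T\<close> at \<open>i\<close>
    is the squared length of column \<open>i\<close>, which contains the nonzero entry
    \<open>T j i\<close>.\<close>
  have "(\<Sum>j\<in>J. (cmod (T j i))\<^sup>2) \<noteq> 0"
    using nz \<open>j \<in> J\<close> fin by (auto simp: sum_nonneg_eq_0_iff)
  then have "c \<noteq> 0" unfolding c_eq of_real_eq_0_iff .
  \<comment> \<open>Bracketing \<open>T T^* T\<close> in its two ways and reading off the entry at
    \<open>(j, i)\<close> gives \<open>c' = c\<close>.\<close>
  have "c' * T j i = (\<Sum>b\<in>J. (\<Sum>a\<in>I. T j a * ?S a b) * T b i)"
    using c' \<open>j \<in> J\<close> fin by (simp add: if_distrib[of "\<lambda>x. x * _"] cong: if_cong)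
  also have "\<dots> = (\<Sum>a\<in>I. T j a * (\<Sum>b\<in>J. ?S a b * T b i))"
    by (simp add: sum_distrib_left sum_distrib_right mult.assoc) (rule sum.swap)
  also have "\<dots> = c * T j i"
    using c \<open>i \<in> I\<close> fin by (simp add: if_distrib[of "\<lambda>x. _ * x"] cong: if_cong)
  finally have "c' = c" using nz by simp
  have "corep_equiv I v J w"
    unfolding corep_equiv_def
  proof (intro exI conjI ballI)
    show "intertwiner I v J w T" by (rule T)
    fix a b assume "a \<in> I" "b \<in> I"
    then show "(\<Sum>j\<in>J. (?S a j / c) * T j b) = (if a = b then 1 else 0)"
      using c[of a b] \<open>c \<noteq> 0\<close> by (auto simp: sum_divide_distrib[symmetric])
  next
    fix a b assume "a \<in> J" "b \<in> J"
    then show "(\<Sum>i\<in>I. T a i * (?S i b / c)) = (if a = b then 1 else 0)"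
      using c'[of a b] \<open>c \<noteq> 0\<close> \<open>c' = c\<close> by (auto simp: sum_divide_distrib[symmetric])
  qed
  with neq show False ..
qed

section \<open>Orthogonality of coefficients under the Haar state\<close>

lemma haar_state_invariant:
  assumes "haar_state \<Delta> h" "finite A" and \<Delta>: "\<Delta> x = (\<Sum>p\<in>A. f p \<otimes> g p)"
  shows "(\<Sum>p\<in>A. h (f p) *\<^sub>C g p) = h x *\<^sub>C 1"
proof -
  \<comment> \<open>\<open>haar_state\<close> speaks of lists of elementary tensors, so the index
    set is enumerated without repetition.\<close>
  obtain L where L: "set L = A" "distinct L" using \<open>finite A\<close> finite_distinct_list by blast
  have "\<Delta> x = (\<Sum>(a, b)\<leftarrow>map (\<lambda>p. (f p, g p)) L. a \<otimes> b)"
    using \<Delta> L by (simp add: comp_def sum.distinct_set_conv_list[symmetric])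
  then have "(\<Sum>(a, b)\<leftarrow>map (\<lambda>p. (f p, g p)) L. h a *\<^sub>C b) = h x *\<^sub>C 1"
    using assms(1) unfolding haar_state_def by blast
  then show ?thesis
    using L by (simp add: comp_def sum.distinct_set_conv_list[symmetric])
qed

text \<open>Put \<open>M p q = h (star (v k p) * w l q)\<close>. The coproduct of
  \<open>star (v k i) * w l j\<close> has the elements under \<open>h\<close> in \<open>M\<close> as
  first legs and \<open>star (v p i) * w q j\<close> as second legs; slicing the first leg with
  \<open>h\<close> therefore gives \<open>v^* M w = M\<close>, suitably indexed (the fact
  \<open>1\<close>). Multiplying by \<open>v\<close> from the left and using
  \<open>v v^* = 1\<close> leaves \<open>M w = v M\<close>.\<close>

lemma haar_intertwiner:
  assumes \<Delta>: "comultiplication \<Delta>" and h: "haar_state \<Delta> h"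
    and v: "unitary_corep \<Delta> I v" and w: "unitary_corep \<Delta> J w"
    and k: "k \<in> I" and l: "l \<in> J"
  shows "intertwiner J w I v (\<lambda>p q. h (star (v k p) * w l q))"
  unfolding intertwiner_def
proof (intro ballI)
  fix r j assume r: "r \<in> I" and j: "j \<in> J"
  have fin: "finite I" "finite J" using v w by (auto simp: unitary_corep_def)
  let ?M = "\<lambda>p q. h (star (v k p) * w l q)"
  have 1: "(\<Sum>p\<in>I. \<Sum>q\<in>J. ?M p q *\<^sub>C (star (v p i) * w q j)) = ?M i j *\<^sub>C 1" if i: "i \<in> I" for i
  proof -
    have hom: "\<Delta> (x * y) = \<Delta> x * \<Delta> y" "\<Delta> (star x) = star (\<Delta> x)" for x y
      using \<Delta> by (auto simp: comultiplication_def unital_star_hom_def)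
    have "\<Delta> (star (v k i) * w l j) =
        star (\<Sum>p\<in>I. v k p \<otimes> v p i) * (\<Sum>q\<in>J. w l q \<otimes> w q j)"
      using v w k l i j by (simp add: hom unitary_corep_def)
    also have "\<dots> = (\<Sum>(p, q)\<in>I \<times> J. (star (v k p) * w l q) \<otimes> (star (v p i) * w q j))"
      by (simp add: star_sum tensor_star sum_product tensor_mult sum.cartesian_product)
    finally have "\<Delta> (star (v k i) * w l j) = (\<Sum>x\<in>I \<times> J.
        (star (v k (fst x)) * w l (snd x)) \<otimes> (star (v (fst x) i) * w (snd x) j))"
      by (simp add: split_def)
    from haar_state_invariant[OF h _ this] show ?thesis
      using fin by (simp add: sum.cartesian_product split_def)
  qed
  have "(\<Sum>q\<in>J. ?M r q *\<^sub>C w q j) =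
      (\<Sum>p\<in>I. \<Sum>q\<in>J. ?M p q *\<^sub>C ((\<Sum>i\<in>I. v r i * star (v p i)) * w q j))"
  proof -
    have "(\<Sum>p\<in>I. \<Sum>q\<in>J. ?M p q *\<^sub>C ((\<Sum>i\<in>I. v r i * star (v p i)) * w q j)) =
        (\<Sum>p\<in>I. if r = p then \<Sum>q\<in>J. ?M p q *\<^sub>C w q j else 0)"
      using v r by (intro sum.cong) (auto simp: unitary_corep_def)
    then show ?thesis using fin r by simp
  qed
  also have "\<dots> = (\<Sum>p\<in>I. \<Sum>q\<in>J. \<Sum>i\<in>I. v r i * ?M p q *\<^sub>C (star (v p i) * w q j))"
    by (simp add: sum_distrib_right scaleC_sum_right mult_scaleC_right mult.assoc)
  also have "\<dots> = (\<Sum>p\<in>I. \<Sum>i\<in>I. \<Sum>q\<in>J. v r i * ?M p q *\<^sub>C (star (v p i) * w q j))"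
    by (rule sum.cong[OF refl]) (rule sum.swap)
  also have "\<dots> = (\<Sum>i\<in>I. \<Sum>p\<in>I. \<Sum>q\<in>J. v r i * ?M p q *\<^sub>C (star (v p i) * w q j))"
    by (rule sum.swap)
  also have "\<dots> = (\<Sum>i\<in>I. v r i * (\<Sum>p\<in>I. \<Sum>q\<in>J. ?M p q *\<^sub>C (star (v p i) * w q j)))"
    by (simp add: sum_distrib_left)
  also have "\<dots> = (\<Sum>i\<in>I. ?M i j *\<^sub>C v r i)"
    using 1 by (intro sum.cong) (simp_all add: mult_scaleC_right)
  finally show "(\<Sum>q\<in>J. ?M r q *\<^sub>C w q j) = (\<Sum>i\<in>I. ?M i j *\<^sub>C v r i)" .
qed

text \<open>By sesquilinearity it suffices to take single coefficients, and their pairings are the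
  entries of the intertwiner from \<open>w\<close> to \<open>v\<close> above, which vanish by
  Schur's lemma.\<close>

lemma haar_orthogonal:
  assumes \<Delta>: "comultiplication \<Delta>" and h: "haar_state \<Delta> h"
    and v: "irreducible_corep \<Delta> I v" and w: "irreducible_corep \<Delta> J w"
    and neq: "\<not> corep_equiv J w I v"
    and x: "x \<in> coeff_space I v" and y: "y \<in> coeff_space J w"
  shows "h (star x * y) = 0"
proof -
  have lin: "clinear h" using h by (simp add: haar_state_def)
  have sc: "h (c *\<^sub>C a) = c * h a" for c a
    using lin by (simp add: clinear_def scaleC_complex_def)
  have uv: "unitary_corep \<Delta> I v" and uw: "unitary_corep \<Delta> J w"
    using v w by (auto simp: irreducible_corep_def)
  have 0: "h (star (v k p) * w l q) = 0" if "k \<in> I" "p \<in> I" "l \<in> J" "q \<in> J" for k p l q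
    using schur[OF w v haar_intertwiner[OF \<Delta> h uv uw that(1,3)] neq that(4,2)] .
  obtain a where a: "x = (\<Sum>i\<in>I. \<Sum>j\<in>I. a i j *\<^sub>C v i j)"
    using x by (auto simp: coeff_space_def)
  obtain b where b: "y = (\<Sum>i\<in>J. \<Sum>j\<in>J. b i j *\<^sub>C w i j)"
    using y by (auto simp: coeff_space_def)
  show ?thesis
    unfolding a b
    by (simp add: star_sum star_scaleC sum_distrib_left sum_distrib_right mult_scaleC_left
        mult_scaleC_right clinear_sum[OF lin] sc 0)
qed


section \<open>Decomposition into coefficient spaces\<close>

definition csubspace :: "'a::complex_vector set \<Rightarrow> bool" where
  "csubspace W \<longleftrightarrow> 0 \<in> W \<and> (\<forall>x\<in>W. \<forall>y\<in>W. x + y \<in> W) \<and> (\<forall>c. \<forall>x\<in>W. c *\<^sub>C x \<in> W)"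

lemma csubspace_sum: "csubspace W \<Longrightarrow> (\<And>a. a \<in> A \<Longrightarrow> f a \<in> W) \<Longrightarrow> sum f A \<in> W"
  by (induction A rule: infinite_finite_induct) (auto simp: csubspace_def)

lemma csubspace_scaleC: "csubspace W \<Longrightarrow> x \<in> W \<Longrightarrow> c *\<^sub>C x \<in> W"
  by (simp add: csubspace_def)

lemma csubspace_coeff_space: "csubspace (coeff_space I v)"
  unfolding csubspace_def coeff_space_def
proof (intro conjI ballI allI)
  let ?f = "\<lambda>c. \<Sum>i\<in>I. \<Sum>j\<in>I. c i j *\<^sub>C v i j"
  show "0 \<in> range ?f"
    by (rule range_eqI[of _ _ "\<lambda>_ _. 0"]) simp
  fix x assume "x \<in> range ?f"
  then obtain a where a: "x = ?f a" by blast
  show "c *\<^sub>C x \<in> range ?f" for c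
    by (rule range_eqI[of _ _ "\<lambda>i j. c * a i j"]) (simp add: a scaleC_sum_right scaleC_scaleC)
  fix y assume "y \<in> range ?f"
  then obtain b where b: "y = ?f b" by blast
  show "x + y \<in> range ?f"
    by (rule range_eqI[of _ _ "\<lambda>i j. a i j + b i j"]) (simp add: a b scaleC_add_left sum.distrib)
qed

lemma coeff_in_coeff_space:
  assumes "finite I" "i \<in> I" "j \<in> I"
  shows "v i j \<in> coeff_space I v"
  unfolding coeff_space_def
proof (rule range_eqI)
  \<comment> \<open>The coefficient matrix is the matrix unit at \<open>(i, j)\<close>, written as a
    product of two deltas so that the sums collapse one after the other.\<close>
  have "(\<Sum>a\<in>I. \<Sum>b\<in>I. ((if i = a then 1 else 0) * (if j = b then 1 else 0)) *\<^sub>C v a b) =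
      (\<Sum>a\<in>I. (if i = a then 1 else 0) *\<^sub>C (\<Sum>b\<in>I. (if j = b then 1 else 0) *\<^sub>C v a b))"
    by (simp only: scaleC_sum_right scaleC_scaleC)
  then show "v i j =
      (\<Sum>a\<in>I. \<Sum>b\<in>I. ((if i = a then 1 else 0) * (if j = b then 1 else 0)) *\<^sub>C v a b)"
    using assms by (simp only: sum_scaleC_delta)
qed

text \<open>If \<open>S T = 1\<close> and \<open>T v = w T\<close>, then \<open>v = S w T\<close>,
  so every coefficient of \<open>v\<close> is a linear combination of coefficients of
  \<open>w\<close>.\<close>

lemma corep_equiv_coeff_in_csubspace:
  assumes eq: "corep_equiv I v J w" and fin: "finite I" "finite J" and W: "csubspace W"
    and w: "\<And>j l. j \<in> J \<Longrightarrow> l \<in> J \<Longrightarrow> w j l \<in> W" and i: "i \<in> I" "i' \<in> I"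
  shows "v i i' \<in> W"
proof -
  obtain T S where T: "intertwiner I v J w T"
    and ST: "\<And>a b. a \<in> I \<Longrightarrow> b \<in> I \<Longrightarrow> (\<Sum>j\<in>J. S a j * T j b) = (if a = b then 1 else 0)"
    using eq unfolding corep_equiv_def by blast
  have "v i i' = (\<Sum>k\<in>I. (if i = k then 1 else 0) *\<^sub>C v k i')"
    using fin i by (simp only: sum_scaleC_delta)
  also have "\<dots> = (\<Sum>k\<in>I. (\<Sum>j\<in>J. S i j * T j k) *\<^sub>C v k i')"
    using i by (intro sum.cong) (simp_all only: ST)
  also have "\<dots> = (\<Sum>j\<in>J. S i j *\<^sub>C (\<Sum>k\<in>I. T j k *\<^sub>C v k i'))"
    by (simp add: scaleC_sum_right scaleC_sum_left scaleC_scaleC) (rule sum.swap)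
  also have "\<dots> = (\<Sum>j\<in>J. S i j *\<^sub>C (\<Sum>l\<in>J. T l i' *\<^sub>C w j l))"
    using T i by (intro sum.cong) (simp_all add: intertwiner_def)
  also have "\<dots> \<in> W"
    by (intro csubspace_sum[OF W] csubspace_scaleC[OF W] w)
  finally show ?thesis .
qed

text \<open>The algebraic sum of all \<open>V_s\<close>; a finitely supported family is encoded as a
  full sequence with a cutoff.\<close>

definition coeff_sums ::
    "(nat \<Rightarrow> nat) \<Rightarrow> (nat \<Rightarrow> nat \<Rightarrow> nat \<Rightarrow> 'n::finite pol) \<Rightarrow> 'n pol set" where
  "coeff_sums d v = {\<Sum>s<n. f s | n f. \<forall>s. f s \<in> coeff_space {..<d s} (v s)}"

text \<open>Padding with zeros beyond \<open>n\<close> makes every larger cutoff admissible, so two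
  elements can share a cutoff, and the range of summation can be made nonempty.\<close>

lemma coeff_sumsE:
  assumes "x \<in> coeff_sums d v"
  obtains n f where "\<And>s. f s \<in> coeff_space {..<d s} (v s)"
    "\<And>m. n \<le> m \<Longrightarrow> x = (\<Sum>s<m. f s)"
proof -
  obtain n f where f: "\<And>s. f s \<in> coeff_space {..<d s} (v s)" and x: "x = (\<Sum>s<n. f s)"
    using assms by (auto simp: coeff_sums_def)
  let ?g = "\<lambda>s. if s < n then f s else 0"
  have "x = (\<Sum>s<m. ?g s)" if "n \<le> m" for m
  proof -
    have "(\<Sum>s<m. ?g s) = (\<Sum>s<n. ?g s)"
      using that by (intro sum.mono_neutral_right) auto
    then show ?thesis by (simp add: x)
  qed
  moreover have "?g s \<in> coeff_space {..<d s} (v s)" for s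
    using f csubspace_coeff_space by (auto simp: csubspace_def)
  ultimately show thesis by (intro that[of ?g n])
qed

lemma csubspace_coeff_sums: "csubspace (coeff_sums d v)"
  unfolding csubspace_def
proof (intro conjI ballI allI)
  let ?V = "\<lambda>s. coeff_space {..<d s} (v s)"
  have V: "csubspace (?V s)" for s by (rule csubspace_coeff_space)
  show "0 \<in> coeff_sums d v"
    unfolding coeff_sums_def using V
    by (intro CollectI exI[of _ 0] exI[of _ "\<lambda>_. 0"]) (simp add: csubspace_def)
  fix x assume "x \<in> coeff_sums d v"
  then obtain n f where f: "\<And>s. f s \<in> ?V s" "\<And>m. n \<le> m \<Longrightarrow> x = (\<Sum>s<m. f s)"
    by (rule coeff_sumsE) blast
  show "c *\<^sub>C x \<in> coeff_sums d v" for c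
    unfolding coeff_sums_def using V f
    by (intro CollectI exI[of _ n] exI[of _ "\<lambda>s. c *\<^sub>C f s"])
      (simp add: csubspace_def f(2)[of n] scaleC_sum_right)
  fix y assume "y \<in> coeff_sums d v"
  then obtain n' f' where f': "\<And>s. f' s \<in> ?V s" "\<And>m. n' \<le> m \<Longrightarrow> y = (\<Sum>s<m. f' s)"
    by (rule coeff_sumsE) blast
  show "x + y \<in> coeff_sums d v"
    unfolding coeff_sums_def using V f(1) f'(1)
    by (intro CollectI exI[of _ "max n n'"] exI[of _ "\<lambda>s. f s + f' s"])
      (simp add: csubspace_def sum.distrib f(2)[of "max n n'"] f'(2)[of "max n n'"])
qed

lemma coeff_space_subset_coeff_sums: "coeff_space {..<d s} (v s) \<subseteq> coeff_sums d v"
proof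
  fix x assume x: "x \<in> coeff_space {..<d s} (v s)"
  have "x = (\<Sum>r<Suc s. if r = s then x else 0)" by simp
  moreover have "(if r = s then x else 0) \<in> coeff_space {..<d r} (v r)" for r
    using x csubspace_coeff_space by (auto simp: csubspace_def)
  ultimately show "x \<in> coeff_sums d v"
    unfolding coeff_sums_def by blast
qed

section \<open>The fusion rules show that the spaces \<open>V_s\<close> span the whole
  algebra\<close>

context
  fixes \<Delta> :: "'n::finite coproduct" and d :: "nat \<Rightarrow> nat"
    and v :: "nat \<Rightarrow> nat \<Rightarrow> nat \<Rightarrow> 'n pol"
  assumes series: "irreducible_series \<Delta> d v"
begin

lemma coeff_in_coeff_sums:
  "i < d s \<Longrightarrow> j < d s \<Longrightarrow> v s i j \<in> coeff_sums d v"
  using coeff_in_coeff_space[of "{..<d s}" i j "v s"] coeff_space_subset_coeff_sums[of d s v] by auto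

lemma coeff_space_0: "x \<in> coeff_space {..<d 0} (v 0) \<longleftrightarrow> (\<exists>c. x = c *\<^sub>C 1)"
  using series by (auto simp: irreducible_series_def coeff_space_def lessThan_Suc)

lemma one_mem_coeff_sums: "1 \<in> coeff_sums d v"
  using coeff_space_0[of 1] coeff_space_subset_coeff_sums[of d 0 v] by (metis scaleC_one subsetD)

lemma zero_mem_coeff_sums: "0 \<in> coeff_sums d v"
  using csubspace_coeff_sums by (auto simp: csubspace_def)

text \<open>The product is a coefficient of the tensor product of \<open>v 1\<close> and
  \<open>v s\<close>, which the fusion rule splits into \<open>v (s + 1)\<close>, \<open>v s\<close>
  and \<open>v (s - 1)\<close>.\<close>

lemma coeff_mult_coeff:
  assumes "i < d 1" "i' < d 1" "j < d s" "j' < d s"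
  shows "v 1 i i' * v s j j' \<in> coeff_sums d v"
proof (cases "s \<ge> 1")
  case True
  let ?K = "{..<d (s + 1)} <+> ({..<d s} <+> {..<d (s - 1)})"
  let ?w = "corep_sum (v (s + 1)) (corep_sum (v s) (v (s - 1)))"
  have eq: "corep_equiv ({..<d 1} \<times> {..<d s}) (corep_tensor (v 1) (v s)) ?K ?w"
    using series True by (simp add: irreducible_series_def)
  have "?w a b \<in> coeff_sums d v" if "a \<in> ?K" "b \<in> ?K" for a b
    using that by (auto simp: coeff_in_coeff_sums zero_mem_coeff_sums)
  from corep_equiv_coeff_in_csubspace[OF eq _ _ csubspace_coeff_sums this, of "(i, j)" "(i', j')"]
  show ?thesis using assms by (simp add: corep_tensor_def)
next
  case False
  \<comment> \<open>The fusion rule starts at \<open>s = 1\<close>; for \<open>s = 0\<close> the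
    second factor is the unit.\<close>
  then have "s = 0" "d 0 = 1" "v 0 0 0 = 1" using series by (auto simp: irreducible_series_def)
  then show ?thesis using assms coeff_in_coeff_sums[of i 1 i'] by simp
qed

lemma coeff_mult_coeff_sums:
  assumes "i < d 1" "i' < d 1" "x \<in> coeff_sums d v"
  shows "v 1 i i' * x \<in> coeff_sums d v"
proof -
  obtain n f where f: "\<And>s. f s \<in> coeff_space {..<d s} (v s)" and x: "x = (\<Sum>s<n. f s)"
    using assms(3) by (auto simp: coeff_sums_def)
  have "v 1 i i' * f s \<in> coeff_sums d v" for s
  proof -
    obtain a where "f s = (\<Sum>j<d s. \<Sum>j'<d s. a j j' *\<^sub>C v s j j')"
      using f[of s] by (auto simp: coeff_space_def)
    then have "v 1 i i' * f s = (\<Sum>j<d s. \<Sum>j'<d s. a j j' *\<^sub>C (v 1 i i' * v s j j'))"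
      by (simp add: sum_distrib_left mult_scaleC_right)
    also have "\<dots> \<in> coeff_sums d v"
      using coeff_mult_coeff[OF assms(1,2)]
      by (intro csubspace_sum csubspace_scaleC csubspace_coeff_sums) auto
    finally show ?thesis .
  qed
  then show ?thesis
    unfolding x sum_distrib_left by (intro csubspace_sum csubspace_coeff_sums)
qed

text \<open>For fixed \<open>x\<close>, the left multipliers that send \<open>x\<close> into
  \<open>coeff_sums\<close> form a subspace. It contains the coefficients of \<open>v 0\<close> and
  \<open>v 1\<close>, hence those of the fundamental corepresentation, which is equivalent to their
  direct sum.\<close>

lemma ugen_mult_coeff_sums:
  assumes "x \<in> coeff_sums d v"
  shows "ugen i j * x \<in> coeff_sums d v"
proof -
  let ?W = "{y. y * x \<in> coeff_sums d v}"
  have sub: "csubspace ?W"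
    using csubspace_coeff_sums[of d v]
    by (simp add: csubspace_def distrib_right mult_scaleC_left)
  let ?K = "{..<d 0} <+> {..<d 1}" and ?w = "corep_sum (v 0) (v 1)"
  have eq: "corep_equiv UNIV ugen ?K ?w" and d0: "d 0 = 1" "v 0 0 0 = 1"
    using series by (auto simp: irreducible_series_def)
  have "?w a b \<in> ?W" if "a \<in> ?K" "b \<in> ?K" for a b
    using that assms coeff_mult_coeff_sums
    by (auto simp: d0 zero_mem_coeff_sums)
  from corep_equiv_coeff_in_csubspace[OF eq _ _ sub this, of i j]
  show ?thesis by simp
qed

text \<open>Words in the generators span the algebra, and each word arises from \<open>1\<close> by
  repeated left multiplication with generators.\<close>

lemma coeff_sums_eq_UNIV: "x \<in> coeff_sums d v"
proof -
  have word: "abs_pol (Poly_Mapping.single (Word xs) 1) \<in> coeff_sums d v" for xs :: "('n \<times> 'n) list"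
  proof (induction xs)
    case Nil
    have "abs_pol (Poly_Mapping.single (Word []) 1) = (1 :: 'n pol)"
      by (simp add: one_pol.abs_eq zero_word_def[symmetric])
    then show ?case by (simp add: one_mem_coeff_sums)
  next
    case (Cons a xs)
    obtain i j where a: "a = (i, j)" by (cases a)
    have "abs_pol (Poly_Mapping.single (Word (a # xs)) 1) =
        ugen i j * abs_pol (Poly_Mapping.single (Word xs) 1)"
      by (simp add: a ugen.abs_eq gen_def times_pol.abs_eq mult_single plus_word_def)
    then show ?case using ugen_mult_coeff_sums[OF Cons] by simp
  qed
  have "abs_pol a \<in> coeff_sums d v" for a :: "'n ncpoly"
  proof (induction a rule: ncpoly_induct)
    case 1
    then show ?case using zero_mem_coeff_sums by (simp add: zero_pol.abs_eq)
  next
    case (2 a w c)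
    have "abs_pol (a + Poly_Mapping.single w c) =
        abs_pol a + c *\<^sub>C abs_pol (Poly_Mapping.single w 1)"
      by (simp add: plus_pol.abs_eq scaleC_pol.abs_eq ncscale_def mult_single)
    also have "\<dots> \<in> coeff_sums d v"
      using 2 word[of "letters w"] csubspace_coeff_sums[of d v] by (simp add: csubspace_def)
    finally show ?case .
  qed
  then show ?thesis by (rule pol.abs_induct)
qed

end


section \<open>Chebyshev polynomials\<close>

text \<open>For \<open>p > s div 2\<close> one has \<open>s - p < p\<close>, so the binomial
  vanishes. This allows a common range of summation for different \<open>s\<close>.\<close>

lemma chebyshev_U_upto:
  assumes "s div 2 \<le> m"
  shows "chebyshev_U s = (\<Sum>p\<le>m. monom ((-1) ^ p * of_nat ((s - p) choose p)) (s - 2 * p))"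
  unfolding chebyshev_U_def
  using assms by (intro sum.mono_neutral_left) (auto simp: binomial_eq_0)

text \<open>The recurrence is Pascal's rule, term by term, with the index in
  \<open>chebyshev_U s\<close> shifted by one.\<close>

lemma chebyshev_U_Suc_Suc: "chebyshev_U (s + 2) = pCons 0 (chebyshev_U (s + 1)) - chebyshev_U s"
proof -
  let ?t = "\<lambda>s p. monom ((-1) ^ p * of_nat ((s - p) choose p)) (s - 2 * p) :: real poly"
  have "?t (s + 2) (Suc q) = pCons 0 (?t (s + 1) (Suc q)) - ?t s q" for q
  proof (cases "q \<le> s")
    case True
    have 1: "pCons 0 (?t (s + 1) (Suc q)) = monom ((-1) ^ Suc q * of_nat ((s - q) choose Suc q)) (s - 2 * q)"
    \<comment> \<open>Multiplication by \<open>X\<close> raises the exponent correctly only if the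
      natural subtraction is not truncated; otherwise the binomial is zero.\<close>
    proof (cases "Suc q \<le> s - q")
      case True
      then have "Suc (s + 1 - 2 * Suc q) = s - 2 * q" by simp
      then show ?thesis by (simp flip: monom_Suc)
    next
      case False
      then show ?thesis by (simp add: binomial_eq_0)
    qed
    have 2: "(Suc s - q) choose Suc q = ((s - q) choose q) + ((s - q) choose Suc q)"
      using True by (simp add: Suc_diff_le)
    show ?thesis
      unfolding 1 using 2 by (simp add: diff_monom algebra_simps)
  next
    case False
    then show ?thesis by (simp add: binomial_eq_0)
  qed
  note step = this
  have pc: "pCons 0 (\<Sum>p\<in>A. f p) = (\<Sum>p\<in>A. pCons 0 (f p))" for A and f :: "nat \<Rightarrow> real poly"
  proof -
    have "pCons 0 (p + q) = pCons 0 p + pCons 0 q" for p q :: "real poly" by simp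
    then show ?thesis by (induction A rule: infinite_finite_induct) (simp_all del: add_pCons)
  qed
  have "chebyshev_U (s + 2) = ?t (s + 2) 0 + (\<Sum>q\<le>s. ?t (s + 2) (Suc q))"
    by (subst chebyshev_U_upto[of _ "Suc s"], simp, subst sum.atMost_Suc_shift, simp)
  also have "\<dots> = (?t (s + 2) 0 + (\<Sum>q\<le>s. pCons 0 (?t (s + 1) (Suc q)))) - (\<Sum>q\<le>s. ?t s q)"
    unfolding step sum_subtractf by simp
  also have "?t (s + 2) 0 + (\<Sum>q\<le>s. pCons 0 (?t (s + 1) (Suc q))) = (\<Sum>q\<le>Suc s. pCons 0 (?t (s + 1) q))"
    by (subst sum.atMost_Suc_shift) (simp add: monom_Suc)
  also have "\<dots> = pCons 0 (chebyshev_U (s + 1))"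
    by (subst chebyshev_U_upto[of "s + 1" "Suc s"]) (simp_all add: pc del: sum.atMost_Suc)
  also have "(\<Sum>q\<le>s. ?t s q) = chebyshev_U s"
    by (rule chebyshev_U_upto[symmetric]) simp
  finally show ?thesis .
qed

lemma chebyshev_U_0: "chebyshev_U 0 = 1"
  by (simp add: chebyshev_U_def)

lemma chebyshev_U_1: "chebyshev_U (Suc 0) = [:0, 1:]"
  by (simp add: chebyshev_U_def monom_altdef)

text \<open>For \<open>x \<ge> 2\<close> the recurrence gives
  \<open>U_{n+2} - U_{n+1} \<ge> U_{n+1} - U_n\<close>, so the values increase from
  \<open>U_0 = 1\<close>. Bound and monotonicity are proved together because each inductive step
  uses both.\<close>

lemma chebyshev_U_ge_1:
  assumes "x \<ge> 2"
  shows "poly (chebyshev_U n) x \<ge> 1 \<and> poly (chebyshev_U n) x \<le> poly (chebyshev_U (Suc n)) x"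
proof (induction n)
  case 0
  then show ?case using assms by (simp add: chebyshev_U_0 chebyshev_U_1)
next
  case (Suc n)
  let ?U = "\<lambda>n. poly (chebyshev_U n) x"
  have "?U (Suc (Suc n)) = x * ?U (Suc n) - ?U n"
    using chebyshev_U_Suc_Suc[of n] by simp
  moreover have "2 * ?U (Suc n) \<le> x * ?U (Suc n)"
    using Suc assms by (intro mult_right_mono) auto
  ultimately show ?case using Suc by linarith
qed

lemma chebyshev_U_deriv_ge:
  assumes "x \<ge> 2"
  shows "real n * poly (chebyshev_U n) x \<le> x * poly (pderiv (chebyshev_U n)) x"
proof -
  let ?U = "\<lambda>n. poly (chebyshev_U n) x"
  define D where "D n = x * poly (pderiv (chebyshev_U n)) x - real n * ?U n" for n
  have D0: "D 0 = 0" "D (Suc 0) = 0"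
    by (simp_all add: D_def chebyshev_U_0 chebyshev_U_1 pderiv_pCons)
  \<comment> \<open>This is the differentiated three-term recurrence: the product-rule term
    \<open>x U_{n+1}\<close> lowers the factor \<open>n + 2\<close> of \<open>x U_{n+1}\<close> to
    \<open>n + 1\<close>, while \<open>(n + 2) U_n\<close> exceeds the \<open>n U_n\<close> in
    \<open>D n\<close> by \<open>2 U_n\<close>.\<close>
  have rec: "D (Suc (Suc n)) = x * D (Suc n) - D n + 2 * ?U n" for n
  proof -
    have eq: "chebyshev_U (Suc (Suc n)) = pCons 0 (chebyshev_U (Suc n)) - chebyshev_U n"
      using chebyshev_U_Suc_Suc[of n] by simp
    show ?thesis
      unfolding D_def eq by (simp add: pderiv_diff pderiv_pCons algebra_simps)
  qed
  have "0 \<le> D n \<and> D n \<le> D (Suc n)" for n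
  proof (induction n)
    case 0
    then show ?case by (simp add: D0)
  next
    case (Suc n)
    have "2 * D (Suc n) \<le> x * D (Suc n)"
      using Suc assms by (intro mult_right_mono) auto
    then show ?case
      using Suc rec[of n] chebyshev_U_ge_1[OF assms, of n] by linarith
  qed
  then show ?thesis by (simp add: D_def)
qed

section \<open>Eigenvalues of the heat generator\<close>

lemma heat_eigenvalue_0: "heat_eigenvalue N 0 = 0"
  by (simp add: heat_eigenvalue_def chebyshev_U_0)

text \<open>With \<open>x = sqrt N \<ge> 2\<close> and index \<open>2 s \<ge> 2\<close>, the
  derivative bound gives \<open>U' / U \<ge> 2 / x\<close>, hence
  \<open>U' / (2 x U) \<ge> 1 / x^2 = 1 / N\<close>.\<close>

lemma heat_eigenvalue_le:
  assumes "N \<ge> 4" "s \<ge> 1"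
  shows "1 / real N \<le> - heat_eigenvalue N s"
proof -
  let ?x = "sqrt (real N)" and ?U = "poly (chebyshev_U (2 * s)) (sqrt (real N))"
    and ?U' = "poly (pderiv (chebyshev_U (2 * s))) (sqrt (real N))"
  have x: "?x \<ge> 2" using assms(1) by (simp add: real_le_rsqrt)
  have U: "?U \<ge> 1" using chebyshev_U_ge_1[OF x] by blast
  have "2 * ?U \<le> real (2 * s) * ?U"
    using U assms(2) by (intro mult_right_mono) auto
  also have "\<dots> \<le> ?x * ?U'" by (rule chebyshev_U_deriv_ge[OF x])
  finally have "?x * (2 * ?U) \<le> ?x * (?x * ?U')" using x by (intro mult_left_mono) auto
  also have "\<dots> = real N * ?U'" by (simp flip: mult.assoc)
  finally have "2 * ?x * ?U \<le> real N * ?U'" by (simp add: mult_ac)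
  moreover have "0 < 2 * ?x * ?U" using x U assms(1) by (intro mult_pos_pos) auto
  ultimately show ?thesis
    using assms(1) by (simp add: heat_eigenvalue_def divide_simps mult_ac)
qed


section \<open>The spectral gap\<close>

text \<open>Positivity of \<open>\<pi> x\<close> on the vectors \<open>\<Lambda> y\<close> makes
  \<open>h (star y * (x * y))\<close> real for all \<open>y\<close>. Polarization between
  \<open>1\<close> and \<open>z\<close> then shows that \<open>h (x * z)\<close> is the conjugate of
  \<open>h (star z * x)\<close>, which is \<open>h (star x * z)\<close>.\<close>

lemma pol_pos_haar_star:
  assumes lin: "clinear h" and gns: "gns_representation h \<Lambda> \<pi>" and x: "x \<in> pol_pos \<pi>"
  shows "h (x * z) = h (star x * z)"
proof -
  have add: "h (a + b) = h a + h b" and sc: "h (c *\<^sub>C a) = c * h a" for a b c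
    using lin by (auto simp: clinear_def scaleC_complex_def)
  have herm: "cnj (h (star a * b)) = h (star b * a)" for a b
    using gns unfolding gns_representation_def by (metis cinner_commute)
  have "0 \<le> cinner \<xi> (\<pi> x \<xi>)" for \<xi>
    using x by (simp add: pol_pos_def is_abs_value_def)
  then have "0 \<le> h (star y * (x * y))" for y
    using gns unfolding gns_representation_def by metis
  then have real: "Im (h (star y * (x * y))) = 0" for y
    by (simp add: less_eq_complex_def)
  have Im: "Im (h (x * z) + h (star z * x)) = 0"
    using real[of "1 + z"] real[of 1] real[of z]
    by (simp add: star_add distrib_left distrib_right add mult.assoc)
  \<comment> \<open>The factor \<open>\<i>\<close> turns the sum of the cross terms into a
    difference and their imaginary part into a real part.\<close>
  have Re: "Re (h (x * z) - h (star z * x)) = 0"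
    using real[of "1 + \<i> *\<^sub>C z"] real[of 1] real[of z]
    by (simp add: star_add star_scaleC distrib_left distrib_right add sc mult.assoc
        mult_scaleC_left mult_scaleC_right)
  have "h (x * z) = cnj (h (star z * x))"
    using Im Re by (simp add: complex_eq_iff)
  then show ?thesis by (simp add: herm)
qed

lemma coeff_spaces_orthogonal:
  assumes "comultiplication \<Delta>" "haar_state \<Delta> h" and series: "irreducible_series \<Delta> d v"
    and "r \<noteq> s" "x \<in> coeff_space {..<d r} (v r)" "y \<in> coeff_space {..<d s} (v s)"
  shows "h (star x * y) = 0"
proof -
  have "irreducible_corep \<Delta> {..<d r} (v r)" "irreducible_corep \<Delta> {..<d s} (v s)"
    "\<not> corep_equiv {..<d s} (v s) {..<d r} (v r)"
    using series \<open>r \<noteq> s\<close> unfolding irreducible_series_def by blast+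
  from haar_orthogonal[OF assms(1,2) this assms(5,6)] show ?thesis .
qed

text \<open>Orthogonality removes the cross terms. The weights \<open>c\<close> allow one formula to
  serve both sides of the inequality: eigenvalues for the energy, constant 1 for the norm.\<close>

lemma haar_star_mult_sums:
  assumes \<Delta>: "comultiplication \<Delta>" and h: "haar_state \<Delta> h" and series: "irreducible_series \<Delta> d v"
    and f: "\<And>s. f s \<in> coeff_space {..<d s} (v s)" and "finite A"
  shows "h (star (\<Sum>s\<in>A. f s) * (\<Sum>s\<in>A. c s *\<^sub>C f s)) = (\<Sum>s\<in>A. c s * h (star (f s) * f s))"
proof -
  have lin: "clinear h" using h by (simp add: haar_state_def)
  have sc: "h (c *\<^sub>C a) = c * h a" for c a
    using lin by (simp add: clinear_def scaleC_complex_def)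
  have orth: "h (star (f r) * f s) = 0" if "r \<noteq> s" for r s
    using coeff_spaces_orthogonal[OF \<Delta> h series that f f] .
  have "h (star (\<Sum>s\<in>A. f s) * (\<Sum>s\<in>A. c s *\<^sub>C f s)) =
      (\<Sum>r\<in>A. \<Sum>s\<in>A. c s * h (star (f r) * f s))"
    by (simp add: star_sum sum_product clinear_sum[OF lin] mult_scaleC_right sc)
  also have "\<dots> = (\<Sum>r\<in>A. \<Sum>s\<in>A. if r = s then c s * h (star (f s) * f s) else 0)"
    by (intro sum.cong) (auto simp: orth)
  finally show ?thesis using \<open>finite A\<close> by simp
qed

theorem proposition3p3:
  fixes \<Delta> :: "'n::finite coproduct"
    and h :: "'n pol \<Rightarrow> complex"
    and d :: "nat \<Rightarrow> nat"
    and v :: "nat \<Rightarrow> nat \<Rightarrow> nat \<Rightarrow> 'n pol"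
    and T_L :: "'n pol \<Rightarrow> 'n pol"
    and \<Lambda> :: "'n pol \<Rightarrow> 'h::complex_hilbert_space"
    and \<pi> :: "'n pol \<Rightarrow> 'h \<Rightarrow> 'h"
  assumes "CARD('n) \<ge> 4"
    and "comultiplication \<Delta>"
    and "haar_state \<Delta> h"
    and "irreducible_series \<Delta> d v"
    and "heat_generator d v T_L"
    and "gns_representation h \<Lambda> \<pi>"
  shows "\<forall>x\<in>pol_pos \<pi>.
    complex_of_real (1 / real CARD('n) * (norm2 h (x - h x *\<^sub>C 1))\<^sup>2) \<le> - h (x * T_L x)"
proof
  fix x assume x: "x \<in> pol_pos \<pi>"
  let ?N = "CARD('n)" and ?V = "\<lambda>s. coeff_space {..<d s} (v s)"
  let ?ev = "heat_eigenvalue CARD('n)"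
  have lin: "clinear h" and h1: "h 1 = 1" and pos: "\<And>x. 0 \<le> h (star x * x)"
    using assms(3) by (auto simp: haar_state_def)
  have sc: "h (c *\<^sub>C a) = c * h a" for c a
    using lin by (simp add: clinear_def scaleC_complex_def)
  obtain n f where f: "\<And>s. f s \<in> ?V s" "\<And>m. n \<le> m \<Longrightarrow> x = (\<Sum>s<m. f s)"
    using coeff_sums_eq_UNIV[OF assms(4)] by (rule coeff_sumsE) blast
  \<comment> \<open>The cutoff \<open>Suc n\<close> guarantees a summand at \<open>s = 0\<close>, to
    be split off below.\<close>
  have x_eq: "x = (\<Sum>s<Suc n. f s)" by (rule f(2)) simp
  \<comment> \<open>\<open>q s\<close> is the squared 2-norm of the component in
    \<open>V_s\<close>.\<close>
  define q where "q s = Re (h (star (f s) * f s))" for s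
  have q: "h (star (f s) * f s) = complex_of_real (q s)" "0 \<le> q s" for s
    using pos[of "f s"] by (auto simp: q_def less_eq_complex_def complex_eq_iff)

  have "T_L x = (\<Sum>s<Suc n. complex_of_real (?ev s) *\<^sub>C f s)"
    using assms(5) f(1) unfolding x_eq heat_generator_def
    by (auto simp: clinear_sum intro!: sum.cong simp del: sum.lessThan_Suc)
  \<comment> \<open>The left factor \<open>x\<close> may be replaced by \<open>star x\<close>, which
    turns the energy into a sesquilinear expression.\<close>
  then have "- h (x * T_L x) =
      - h (star (\<Sum>s<Suc n. f s) * (\<Sum>s<Suc n. complex_of_real (?ev s) *\<^sub>C f s))"
    using pol_pos_haar_star[OF lin assms(6) x] x_eq by simp
  also have "\<dots> = - (\<Sum>s<Suc n. complex_of_real (?ev s) * h (star (f s) * f s))"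
    by (subst haar_star_mult_sums[OF assms(2-4) f(1)]) auto
  also have "\<dots> = complex_of_real (\<Sum>s<Suc n. - ?ev s * q s)"
    by (simp add: q sum_negf)
  \<comment> \<open>The constant component carries no energy, its eigenvalue being 0.\<close>
  also have "(\<Sum>s<Suc n. - ?ev s * q s) = (\<Sum>s<n. - ?ev (Suc s) * q (Suc s))"
    by (subst sum.lessThan_Suc_shift) (simp add: heat_eigenvalue_0)
  finally have rhs: "- h (x * T_L x) = complex_of_real (\<Sum>s<n. - ?ev (Suc s) * q (Suc s))" .

  \<comment> \<open>The component in \<open>V_0\<close> is \<open>h x\<close> times the unit: all
    other components are orthogonal to \<open>1\<close>, so \<open>h\<close> vanishes on
    them.\<close>
  obtain c where c: "f 0 = c *\<^sub>C 1"
    using f(1)[of 0] coeff_space_0[OF assms(4)] by blast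
  have one: "1 \<in> ?V 0"
    using coeff_space_0[OF assms(4)] scaleC_one by metis
  have "h (f (Suc s)) = 0" for s
  proof -
    have "h (star 1 * f (Suc s)) = 0"
      by (rule coeff_spaces_orthogonal[OF assms(2-4) _ one f(1)]) simp
    then show ?thesis by simp
  qed
  then have "h x = c"
    unfolding x_eq sum.lessThan_Suc_shift using lin
    by (simp add: clinear_def clinear_sum[OF lin] c sc h1)
  then have "x - h x *\<^sub>C 1 = (\<Sum>s<n. f (Suc s))"
    unfolding x_eq sum.lessThan_Suc_shift by (simp add: c)
  also have "\<dots> = (\<Sum>s\<in>{1..n}. f s)"
    by (simp add: sum.shift_bounds_Suc_ivl image_Suc_lessThan flip: sum.atLeast1_atMost_eq)
  finally have "h (star (x - h x *\<^sub>C 1) * (x - h x *\<^sub>C 1)) =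
      h (star (\<Sum>s\<in>{1..n}. f s) * (\<Sum>s\<in>{1..n}. 1 *\<^sub>C f s))"
    by (simp add: scaleC_one)
  also have "\<dots> = (\<Sum>s\<in>{1..n}. 1 * h (star (f s) * f s))"
    by (rule haar_star_mult_sums[OF assms(2-4) f(1)]) auto
  also have "\<dots> = complex_of_real (\<Sum>s<n. q (Suc s))"
    by (simp add: q sum.atLeast1_atMost_eq)
  finally have "(norm2 h (x - h x *\<^sub>C 1))\<^sup>2 = (\<Sum>s<n. q (Suc s))"
    by (simp add: norm2_def q sum_nonneg)
  then have "1 / real ?N * (norm2 h (x - h x *\<^sub>C 1))\<^sup>2 = (\<Sum>s<n. 1 / real ?N * q (Suc s))"
    by (simp only: sum_distrib_left)
  \<comment> \<open>Both sides are now weighted sums of the same \<open>q (Suc s) \<ge> 0\<close>,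
    compared term by term through the eigenvalue bound.\<close>
  also have "\<dots> \<le> (\<Sum>s<n. - ?ev (Suc s) * q (Suc s))"
    using heat_eigenvalue_le[OF assms(1)] q(2) by (intro sum_mono mult_right_mono) auto
  finally show "complex_of_real (1 / real ?N * (norm2 h (x - h x *\<^sub>C 1))\<^sup>2) \<le> - h (x * T_L x)"
    unfolding rhs by (simp add: less_eq_complex_def)
qed

end
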